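(* Let $(M,F)$ be a Finsler manifold and let $I\subset\mathbb{R}$ be a bounded closed interval. Then $$\mathsf{FAC}^p(I;M)=\mathsf{BAC}^p(I;M)=\mathsf{AC}^p(I;M)\qquad\text{for all } p\in[1,\infty].$$
   Context: A Finsler manifold $(M,F)$ is a connected smooth manifold $M$ without boundary of dimension $n\ge 2$ with a continuous function $F:TM\to[0,\infty)$ such that (a) $F\in C^\infty(TM\setminus\{0\})$; (b) $F(x,\lambda y)=\lambda F(x,y)$ for all $\lambda\ge 0$; (c) the matrix $g_{ij}(x,y)=[\frac12F^2]_{y^iy^j}(x,y)$ is positive definite for $y\neq 0$. $F(x,-y)=F(x,y)$ is not assumed, and no completeness is assumed. The (generally non-symmetric) distance is $d_F(p,q)=\inf\int_0^1F(\gamma'(t))\,dt$ over piecewise smooth curves $\gamma:[0,1]\to M$ from $p$ to $q$. For $p\in[1,\infty]$, $\mathsf{FAC}^p(I;M)$ (resp. $\mathsf{BAC}^p(I;M)$) is the class of maps $\gamma:I\to M$ for which there is a nonnegative $f\in L^p(I)$ with $d_F(\gamma(t_1),\gamma(t_2))\le\int_{t_1}^{t_2}f(s)\,ds$ (resp. $d_F(\gamma(t_2),\gamma(t_1))\le\int_{t_1}^{t_2}f(s)\,ds$) for all $t_1\le t_2$ in $I$; and $\mathsf{AC}^p(I;M)=\mathsf{FAC}^p(I;M)\cap\mathsf{BAC}^p(I;M)$. *)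

theory Defs
  imports "HOL-Analysis.Analysis"
begin

section \<open>Smooth maps between open subsets of normed spaces\<close>

text \<open>Both notions are meant for open sets: the derivatives are taken with respect to the
  whole space. \<open>Ck_on k S f\<close> says that all iterated directional derivatives of \<open>f\<close> up to order
  \<open>k\<close> exist and are continuous on \<open>S\<close>.\<close>

primrec Ck_on :: "nat \<Rightarrow> 'a::real_normed_vector set \<Rightarrow> ('a \<Rightarrow> 'b::real_normed_vector) \<Rightarrow> bool" where
  "Ck_on 0 S f \<longleftrightarrow> continuous_on S f"
| "Ck_on (Suc k) S f \<longleftrightarrow> (\<forall>x\<in>S. f differentiable (at x)) \<and>
     (\<forall>v. Ck_on k S (\<lambda>x. frechet_derivative f (at x) v))"

definition smooth_on :: "'a::real_normed_vector set \<Rightarrow> ('a \<Rightarrow> 'b::real_normed_vector) \<Rightarrow> bool" where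
  "smooth_on S f \<longleftrightarrow> (\<forall>k. Ck_on k S f)"


section \<open>Smooth manifolds\<close>

text \<open>The underlying space of a manifold is a whole type \<open>'m\<close>, and its dimension is
  \<open>CARD('n)\<close>. A chart is a pair of its domain and its coordinate map; the values of
  the coordinate map outside the domain are irrelevant. The atlas need not be maximal.\<close>

type_synonym ('m, 'n) chart = "'m set \<times> ('m \<Rightarrow> real ^ 'n)"

definition chart_inv :: "('m, 'n) chart \<Rightarrow> real ^ 'n \<Rightarrow> 'm" where
  "chart_inv c = inv_into (fst c) (snd c)"

definition is_chart :: "('m::topological_space, 'n::finite) chart \<Rightarrow> bool" where
  "is_chart c \<longleftrightarrow> open (fst c) \<and> open (snd c ` fst c) \<and>
     homeomorphism (fst c) (snd c ` fst c) (snd c) (chart_inv c)"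

definition transition :: "('m, 'n) chart \<Rightarrow> ('m, 'n) chart \<Rightarrow> real ^ 'n \<Rightarrow> real ^ 'n" where
  "transition c c' = snd c' \<circ> chart_inv c"

definition smooth_atlas :: "('m::topological_space, 'n::finite) chart set \<Rightarrow> bool" where
  "smooth_atlas A \<longleftrightarrow> (\<forall>c\<in>A. is_chart c) \<and> (\<Union>c\<in>A. fst c) = UNIV \<and>
     (\<forall>c\<in>A. \<forall>c'\<in>A. smooth_on (snd c ` (fst c \<inter> fst c')) (transition c c'))"

definition charts_at :: "('m, 'n) chart set \<Rightarrow> 'm \<Rightarrow> ('m, 'n) chart set" where
  "charts_at A x = {c \<in> A. x \<in> fst c}"

text \<open>A tangent vector at \<open>x\<close> assigns to every chart around \<open>x\<close> its coordinate vector in that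
  chart, subject to the usual transformation law.\<close>

definition tangent_space ::
    "('m, 'n::finite) chart set \<Rightarrow> 'm \<Rightarrow> (('m, 'n) chart \<Rightarrow> real ^ 'n) set" where
  "tangent_space A x = {v \<in> extensional (charts_at A x).
     \<forall>c\<in>charts_at A x. \<forall>c'\<in>charts_at A x.
       v c' = frechet_derivative (transition c c') (at (snd c x)) (v c)}"

text \<open>The tangent vector \<open>y\<^sup>i \<partial>\<^sub>i\<close> at \<open>x\<close> whose coordinates in the chart \<open>c\<close> are \<open>y\<close>.\<close>

definition tangent_of :: "('m, 'n::finite) chart set \<Rightarrow> ('m, 'n) chart \<Rightarrow> 'm \<Rightarrow> real ^ 'n
    \<Rightarrow> ('m, 'n) chart \<Rightarrow> real ^ 'n" where
  "tangent_of A c x y =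
     (\<lambda>c'\<in>charts_at A x. frechet_derivative (transition c c') (at (snd c x)) y)"

definition tangent_scale :: "('m, 'n::finite) chart set \<Rightarrow> 'm \<Rightarrow> real
    \<Rightarrow> (('m, 'n) chart \<Rightarrow> real ^ 'n) \<Rightarrow> ('m, 'n) chart \<Rightarrow> real ^ 'n" where
  "tangent_scale A x r v = (\<lambda>c\<in>charts_at A x. r *\<^sub>R v c)"

text \<open>The velocity of a curve at a time \<open>t\<close> at which it is differentiable.\<close>

definition velocity :: "('m, 'n::finite) chart set \<Rightarrow> (real \<Rightarrow> 'm) \<Rightarrow> real
    \<Rightarrow> ('m, 'n) chart \<Rightarrow> real ^ 'n" where
  "velocity A \<gamma> t = (\<lambda>c\<in>charts_at A (\<gamma> t). vector_derivative (snd c \<circ> \<gamma>) (at t))"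

definition smooth_curve_on :: "('m::topological_space, 'n::finite) chart set \<Rightarrow> real set
    \<Rightarrow> (real \<Rightarrow> 'm) \<Rightarrow> bool" where
  "smooth_curve_on A J \<gamma> \<longleftrightarrow> open J \<and> continuous_on J \<gamma> \<and>
     (\<forall>c\<in>A. smooth_on (J \<inter> \<gamma> -` fst c) (snd c \<circ> \<gamma>))"

text \<open>Smoothness on a closed interval, including the end points, means extendability to a
  smooth curve on an open neighbourhood.\<close>

definition smooth_curve_on_Icc :: "('m::topological_space, 'n::finite) chart set \<Rightarrow> real \<Rightarrow> real
    \<Rightarrow> (real \<Rightarrow> 'm) \<Rightarrow> bool" where
  "smooth_curve_on_Icc A a b \<gamma> \<longleftrightarrow>
     (\<exists>J \<eta>. {a..b} \<subseteq> J \<and> smooth_curve_on A J \<eta> \<and> (\<forall>t\<in>{a..b}. \<eta> t = \<gamma> t))"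

text \<open>Continuity on \<open>{0..1}\<close> is implied, since consecutive pieces share their end points.\<close>

definition piecewise_smooth_curve :: "('m::topological_space, 'n::finite) chart set
    \<Rightarrow> (real \<Rightarrow> 'm) \<Rightarrow> bool" where
  "piecewise_smooth_curve A \<gamma> \<longleftrightarrow>
     (\<exists>(\<tau> :: nat \<Rightarrow> real) k. \<tau> 0 = 0 \<and> \<tau> k = 1 \<and>
        (\<forall>i<k. \<tau> i < \<tau> (Suc i) \<and> smooth_curve_on_Icc A (\<tau> i) (\<tau> (Suc i)) \<gamma>))"


section \<open>Finsler manifolds\<close>

text \<open>A function \<open>F\<close> on the tangent bundle is given in curried form; only its values \<open>F x v\<close>
  with \<open>v \<in> tangent_space A x\<close> matter. \<open>local_rep A F c\<close> is \<open>F\<close> in the bundle coordinates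
  \<open>(u, y)\<close> induced by \<open>c\<close>. As these are the charts of the tangent bundle, \<open>F\<close> is continuous
  (smooth away from the zero section) if and only if all its local representations are.\<close>

definition local_rep :: "('m, 'n::finite) chart set \<Rightarrow> ('m \<Rightarrow> (('m, 'n) chart \<Rightarrow> real ^ 'n) \<Rightarrow> real)
    \<Rightarrow> ('m, 'n) chart \<Rightarrow> (real ^ 'n) \<times> (real ^ 'n) \<Rightarrow> real" where
  "local_rep A F c = (\<lambda>(u, y). F (chart_inv c u) (tangent_of A c (chart_inv c u) y))"

definition partial_deriv :: "'n::finite \<Rightarrow> (real ^ 'n \<Rightarrow> real) \<Rightarrow> real ^ 'n \<Rightarrow> real" where
  "partial_deriv i f y = frechet_derivative f (at y) (axis i 1)"

definition fundamental_tensor :: "('m, 'n::finite) chart set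
    \<Rightarrow> ('m \<Rightarrow> (('m, 'n) chart \<Rightarrow> real ^ 'n) \<Rightarrow> real) \<Rightarrow> ('m, 'n) chart
    \<Rightarrow> real ^ 'n \<Rightarrow> real ^ 'n \<Rightarrow> real ^ 'n ^ 'n" where
  "fundamental_tensor A F c u y =
     (\<chi> i j. partial_deriv j (partial_deriv i (\<lambda>z. 1 / 2 * (local_rep A F c (u, z))\<^sup>2)) y)"

definition positive_definite :: "real ^ 'n ^ 'n::finite \<Rightarrow> bool" where
  "positive_definite G \<longleftrightarrow> transpose G = G \<and> (\<forall>x. x \<noteq> 0 \<longrightarrow> 0 < x \<bullet> (G *v x))"

definition finsler_structure :: "('m, 'n::finite) chart set
    \<Rightarrow> ('m \<Rightarrow> (('m, 'n) chart \<Rightarrow> real ^ 'n) \<Rightarrow> real) \<Rightarrow> bool" where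
  "finsler_structure A F \<longleftrightarrow>
     (\<forall>x. \<forall>v\<in>tangent_space A x. 0 \<le> F x v) \<and>
     (\<forall>c\<in>A. continuous_on (snd c ` fst c \<times> UNIV) (local_rep A F c)) \<and>
     (\<forall>c\<in>A. smooth_on (snd c ` fst c \<times> (UNIV - {0})) (local_rep A F c)) \<and>
     (\<forall>x. \<forall>v\<in>tangent_space A x. \<forall>r\<ge>0. F x (tangent_scale A x r v) = r * F x v) \<and>
     (\<forall>c\<in>A. \<forall>u\<in>snd c ` fst c. \<forall>y. y \<noteq> 0 \<longrightarrow>
        positive_definite (fundamental_tensor A F c u y))"

definition finsler_manifold ::
    "('m::{t2_space, second_countable_topology}, 'n::finite) chart set
     \<Rightarrow> ('m \<Rightarrow> (('m, 'n) chart \<Rightarrow> real ^ 'n) \<Rightarrow> real) \<Rightarrow> bool" where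
  "finsler_manifold A F \<longleftrightarrow> connected (UNIV :: 'm set) \<and> 2 \<le> CARD('n) \<and>
     smooth_atlas A \<and> finsler_structure A F"

text \<open>The integrand may be meaningless at the finitely many break points of the curve, which does
  not affect the integral.\<close>

definition finsler_length :: "('m, 'n::finite) chart set
    \<Rightarrow> ('m \<Rightarrow> (('m, 'n) chart \<Rightarrow> real ^ 'n) \<Rightarrow> real) \<Rightarrow> (real \<Rightarrow> 'm) \<Rightarrow> real" where
  "finsler_length A F \<gamma> = integral {0..1} (\<lambda>t. F (\<gamma> t) (velocity A \<gamma> t))"

definition finsler_dist :: "('m::topological_space, 'n::finite) chart set
    \<Rightarrow> ('m \<Rightarrow> (('m, 'n) chart \<Rightarrow> real ^ 'n) \<Rightarrow> real) \<Rightarrow> 'm \<Rightarrow> 'm \<Rightarrow> real" where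
  "finsler_dist A F p q =
     Inf {finsler_length A F \<gamma> | \<gamma>. piecewise_smooth_curve A \<gamma> \<and> \<gamma> 0 = p \<and> \<gamma> 1 = q}"


section \<open>Absolutely continuous curves\<close>

definition Lp_on :: "ennreal \<Rightarrow> real set \<Rightarrow> (real \<Rightarrow> real) set" where
  "Lp_on p I = {f \<in> borel_measurable (lebesgue_on I).
     if p = \<infinity> then \<exists>C. AE s in lebesgue_on I. \<bar>f s\<bar> \<le> C
     else integrable (lebesgue_on I) (\<lambda>s. \<bar>f s\<bar> powr enn2real p)}"

text \<open>Maps on \<open>I\<close> are represented by the extensional functions on \<open>I\<close>, so that equality of the
  following sets is equality of classes of maps \<open>I \<rightarrow> M\<close>.\<close>

definition FAC :: "('m::topological_space, 'n::finite) chart set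
    \<Rightarrow> ('m \<Rightarrow> (('m, 'n) chart \<Rightarrow> real ^ 'n) \<Rightarrow> real) \<Rightarrow> ennreal \<Rightarrow> real set \<Rightarrow> (real \<Rightarrow> 'm) set" where
  "FAC A F p I = {\<gamma> \<in> extensional I. \<exists>f\<in>Lp_on p I. (\<forall>s\<in>I. 0 \<le> f s) \<and>
     (\<forall>t1\<in>I. \<forall>t2\<in>I. t1 \<le> t2 \<longrightarrow>
        finsler_dist A F (\<gamma> t1) (\<gamma> t2) \<le> (LINT s:{t1..t2}|lebesgue. f s))}"

definition BAC :: "('m::topological_space, 'n::finite) chart set
    \<Rightarrow> ('m \<Rightarrow> (('m, 'n) chart \<Rightarrow> real ^ 'n) \<Rightarrow> real) \<Rightarrow> ennreal \<Rightarrow> real set \<Rightarrow> (real \<Rightarrow> 'm) set" where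
  "BAC A F p I = {\<gamma> \<in> extensional I. \<exists>f\<in>Lp_on p I. (\<forall>s\<in>I. 0 \<le> f s) \<and>
     (\<forall>t1\<in>I. \<forall>t2\<in>I. t1 \<le> t2 \<longrightarrow>
        finsler_dist A F (\<gamma> t2) (\<gamma> t1) \<le> (LINT s:{t1..t2}|lebesgue. f s))}"

definition AC :: "('m::topological_space, 'n::finite) chart set
    \<Rightarrow> ('m \<Rightarrow> (('m, 'n) chart \<Rightarrow> real ^ 'n) \<Rightarrow> real) \<Rightarrow> ennreal \<Rightarrow> real set \<Rightarrow> (real \<Rightarrow> 'm) set" where
  "AC A F p I = FAC A F p I \<inter> BAC A F p I"

end

theory Submission
  imports Defs
begin

text \<open>In a chart around a point the Finsler function is bounded above and below by multiples of the
  Euclidean norm. Straight segments and curves leaving a small coordinate ball then show that \<open>d\<^sub>F\<close> is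
  locally comparable with the coordinate distance, hence with its own reversal, and that both
  \<open>d\<^sub>F(x, y)\<close> and \<open>d\<^sub>F(y, x)\<close> can be small only for \<open>y\<close> near \<open>x\<close>. So a curve in \<open>FAC\<close> is continuous, and
  reversing its distances costs a bounded factor near each time. Compactness of the interval makes
  the factor uniform, and multiplying the \<open>L\<^sup>p\<close> bound by it gives a bound for \<open>BAC\<close>. The argument is
  symmetric in the two directions.\<close>

section \<open>Smooth maps\<close>

text \<open>In general no single constant compares d_F with its reversal on all of M, so the
  comparison stays local and its constants are collected only along the image of one curve. Two
  points of that image need not share a chart; what survives chaining by the triangle inequality is
  a bound by increments of the additive function \<open>integral {a..t} f\<close>, not a bound of
  \<open>d q p\<close> by \<open>d p q\<close>. The lower bound for F rests on F > 0 off the zero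
  section, which is not an axiom but is extracted from positive definiteness of the fundamental
  tensor. The lower bound for d_F must also cover curves that leave the coordinate ball: they are
  charged for the part up to the first exit or after the last entry. The second case cannot be
  obtained by running the curve backwards, since F need not be reversible. The final argument
  concerns an abstract function \<open>D\<close> with a triangle inequality and two local
  properties. These hypotheses are stable under swapping the arguments of \<open>D\<close>, so one
  lemma serves both inclusions.\<close>

lemma differentiable_cong_open:
  assumes "open S" "x \<in> S" "\<And>y. y \<in> S \<Longrightarrow> f y = g y" "f differentiable (at x)"
  shows "g differentiable (at x)"
  using assms by (meson differentiable_def has_derivative_transform_within_open)

lemma Ck_on_cong:
  assumes "open S" "\<And>x. x \<in> S \<Longrightarrow> f x = g x" "Ck_on k S f"
  shows "Ck_on k S g"
  using assms(2,3)
proof (induction k arbitrary: f g)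
  case 0
  then show ?case by (simp cong: continuous_on_cong)
next
  case (Suc k)
  have "frechet_derivative f (at x) v = frechet_derivative g (at x) v" if "x \<in> S" for x v
    using frechet_derivative_transform_within_open[of f x S g] Suc.prems that \<open>open S\<close> by simp
  then have "Ck_on k S (\<lambda>x. frechet_derivative g (at x) v)" for v
    using Suc.IH[of "\<lambda>x. frechet_derivative f (at x) v"] Suc.prems(2) by simp
  moreover have "g differentiable (at x)" if "x \<in> S" for x
    using differentiable_cong_open[OF \<open>open S\<close> that Suc.prems(1)] Suc.prems(2) that by simp
  ultimately show ?case by simp
qed

lemma Ck_on_subset: "Ck_on k S f \<Longrightarrow> T \<subseteq> S \<Longrightarrow> Ck_on k T f"
  by (induction k arbitrary: f) (auto intro: continuous_on_subset)

lemma frechet_derivative_affine: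
  assumes "bounded_linear L" "f differentiable (at (a + L x))"
  shows "(\<lambda>x. f (a + L x)) differentiable (at x)"
    and "frechet_derivative (\<lambda>x. f (a + L x)) (at x) = (\<lambda>v. frechet_derivative f (at (a + L x)) (L v))"
proof -
  have "((\<lambda>x. a + L x) has_derivative L) (at x)"
    using has_derivative_add[OF has_derivative_const bounded_linear_imp_has_derivative[OF assms(1)]]
    by simp
  moreover have "(f has_derivative frechet_derivative f (at (a + L x))) (at (a + L x))"
    using assms(2) frechet_derivative_works by blast
  ultimately have "((\<lambda>x. f (a + L x)) has_derivative
      (\<lambda>v. frechet_derivative f (at (a + L x)) (L v))) (at x)"
    using diff_chain_at[of "\<lambda>x. a + L x" L x f] by (simp add: o_def)
  then show "(\<lambda>x. f (a + L x)) differentiable (at x)"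
    "frechet_derivative (\<lambda>x. f (a + L x)) (at x) = (\<lambda>v. frechet_derivative f (at (a + L x)) (L v))"
    by (auto simp: differentiable_def intro: frechet_derivative_at[symmetric])
qed

text \<open>Differentiating f(a + L x) along v gives the derivative of f along the fixed direction L
  v, composed with the same affine map, so the induction on k closes. Affine inner maps cover the
  uses below: freezing the base point in \<open>local_rep\<close>, reparametrizing curves,
  parametrizing segments.\<close>

lemma Ck_on_affine:
  assumes "open S" "bounded_linear L" "Ck_on k S f"
  shows "Ck_on k ((\<lambda>x. a + L x) -` S) (\<lambda>x. f (a + L x))"
  using assms(3)
proof (induction k arbitrary: f)
  case 0
  have "continuous_on ((\<lambda>x. a + L x) -` S) (\<lambda>x. a + L x)"
    by (intro continuous_intros linear_continuous_on assms)
  then show ?case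
    using 0 continuous_on_compose2[of S f _ "\<lambda>x. a + L x"] by auto
next
  case (Suc k)
  have "continuous_on UNIV (\<lambda>x. a + L x)"
    by (intro continuous_intros linear_continuous_on assms)
  then have o: "open ((\<lambda>x. a + L x) -` S)"
    using \<open>open S\<close> continuous_on_open_vimage[of UNIV] by (simp add: open_vimage)
  have "Ck_on k ((\<lambda>x. a + L x) -` S) (\<lambda>x. frechet_derivative (\<lambda>x. f (a + L x)) (at x) v)" for v
    by (rule Ck_on_cong[OF o _ Suc.IH[of "\<lambda>x. frechet_derivative f (at x) (L v)"]])
      (use Suc.prems frechet_derivative_affine[OF assms(2), of f a] in auto)
  then show ?case
    using Suc.prems frechet_derivative_affine(1)[OF assms(2), of f a] by auto
qed

lemma smooth_on_cong:
  "open S \<Longrightarrow> (\<And>x. x \<in> S \<Longrightarrow> f x = g x) \<Longrightarrow> smooth_on S f \<Longrightarrow> smooth_on S g"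
  using Ck_on_cong unfolding smooth_on_def by blast

lemma smooth_on_subset: "smooth_on S f \<Longrightarrow> T \<subseteq> S \<Longrightarrow> smooth_on T f"
  using Ck_on_subset unfolding smooth_on_def by blast

lemma smooth_on_affine:
  "open S \<Longrightarrow> bounded_linear L \<Longrightarrow> smooth_on S f \<Longrightarrow>
     smooth_on ((\<lambda>x. a + L x) -` S) (\<lambda>x. f (a + L x))"
  using Ck_on_affine unfolding smooth_on_def by blast

lemma smooth_on_imp_continuous_on: "smooth_on S f \<Longrightarrow> continuous_on S f"
  unfolding smooth_on_def by (metis Ck_on.simps(1))

lemma smooth_on_imp_differentiable: "smooth_on S f \<Longrightarrow> x \<in> S \<Longrightarrow> f differentiable (at x)"
  unfolding smooth_on_def by (metis Ck_on.simps(2))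

lemma smooth_on_frechet_derivative:
  "smooth_on S f \<Longrightarrow> smooth_on S (\<lambda>x. frechet_derivative f (at x) v)"
  unfolding smooth_on_def by (metis Ck_on.simps(2))

lemma smooth_on_continuous_vector_derivative:
  assumes "smooth_on S f"
  shows "continuous_on S (\<lambda>t. vector_derivative f (at t))"
proof -
  have "continuous_on S (\<lambda>t. frechet_derivative f (at t) 1)"
    by (rule smooth_on_imp_continuous_on[OF smooth_on_frechet_derivative[OF assms]])
  moreover have "frechet_derivative f (at t) 1 = vector_derivative f (at t)" if "t \<in> S" for t
    using frechet_derivative_eq_vector_derivative[OF smooth_on_imp_differentiable[OF assms that]]
    by simp
  ultimately show ?thesis by (simp cong: continuous_on_cong)
qed

lemma has_vector_derivative_compose_frechet:
  assumes "(f has_vector_derivative f') (at x)" "g differentiable (at (f x))"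
  shows "((\<lambda>t. g (f t)) has_vector_derivative frechet_derivative g (at (f x)) f') (at x)"
proof -
  have g: "(g has_derivative frechet_derivative g (at (f x))) (at (f x))"
    using assms(2) frechet_derivative_works by blast
  then have "((\<lambda>t. g (f t)) has_derivative (\<lambda>t. frechet_derivative g (at (f x)) (t *\<^sub>R f'))) (at x)"
    using diff_chain_at[OF assms(1)[unfolded has_vector_derivative_def] g] by (simp add: o_def)
  moreover have "linear (frechet_derivative g (at (f x)))"
    using g has_derivative_linear by blast
  ultimately show ?thesis
    by (simp add: has_vector_derivative_def linear_cmul)
qed

lemma vector_derivative_cong_open:
  assumes "open S" "x \<in> S" "\<And>y. y \<in> S \<Longrightarrow> f y = g y"
  shows "vector_derivative f (at x) = vector_derivative g (at x)"
  using assms by (intro vector_derivative_cong_eq) (auto simp: eventually_nhds)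

section \<open>Finsler functions in charts\<close>

locale finsler =
  fixes A :: "('m::{t2_space, second_countable_topology}, 'n::finite) chart set"
    and F :: "'m \<Rightarrow> (('m, 'n) chart \<Rightarrow> real ^ 'n) \<Rightarrow> real"
  assumes finsler_manifold: "finsler_manifold A F"
begin

lemma chart: "c \<in> A \<Longrightarrow> is_chart c"
  using finsler_manifold by (auto simp: finsler_manifold_def smooth_atlas_def)

lemma ex_chart: "\<exists>c\<in>A. x \<in> fst c"
  using finsler_manifold by (auto simp: finsler_manifold_def smooth_atlas_def)

lemma open_chart_domain: "c \<in> A \<Longrightarrow> open (fst c)"
  and open_chart_range: "c \<in> A \<Longrightarrow> open (snd c ` fst c)"
  and chart_homeomorphism: "c \<in> A \<Longrightarrow> homeomorphism (fst c) (snd c ` fst c) (snd c) (chart_inv c)"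
  using chart by (auto simp: is_chart_def)

lemma continuous_on_chart: "c \<in> A \<Longrightarrow> continuous_on (fst c) (snd c)"
  and continuous_on_chart_inv: "c \<in> A \<Longrightarrow> continuous_on (snd c ` fst c) (chart_inv c)"
  and chart_inv_chart: "c \<in> A \<Longrightarrow> x \<in> fst c \<Longrightarrow> chart_inv c (snd c x) = x"
  using chart_homeomorphism by (auto simp: homeomorphism_def)

lemma chart_chart_inv: "c \<in> A \<Longrightarrow> u \<in> snd c ` fst c \<Longrightarrow> snd c (chart_inv c u) = u"
  and chart_inv_in: "c \<in> A \<Longrightarrow> u \<in> snd c ` fst c \<Longrightarrow> chart_inv c u \<in> fst c"
  by (auto simp: chart_inv_chart)

lemma transition_chart: "c \<in> A \<Longrightarrow> x \<in> fst c \<Longrightarrow> transition c c' (snd c x) = snd c' x"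
  by (simp add: transition_def chart_inv_chart)

lemma open_chart_image:
  assumes "c \<in> A" "open V" "V \<subseteq> fst c"
  shows "open (snd c ` V)"
proof -
  have "openin (top_of_set (fst c)) V"
    using assms open_chart_domain by (auto simp: openin_open_eq)
  then show ?thesis
    using homeomorphism_imp_open_map[OF chart_homeomorphism[OF assms(1)]]
      open_chart_range[OF assms(1)] by (auto simp: openin_open_eq)
qed

lemma open_chart_vimage: "c \<in> A \<Longrightarrow> open B \<Longrightarrow> open (fst c \<inter> snd c -` B)"
  using continuous_open_preimage continuous_on_chart open_chart_domain by blast

lemma smooth_transition:
  "c \<in> A \<Longrightarrow> c' \<in> A \<Longrightarrow> smooth_on (snd c ` (fst c \<inter> fst c')) (transition c c')"
  using finsler_manifold by (auto simp: finsler_manifold_def smooth_atlas_def)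

lemma transition_differentiable:
  assumes "c \<in> A" "c' \<in> A" "x \<in> fst c" "x \<in> fst c'"
  shows "transition c c' differentiable (at (snd c x))"
  using smooth_on_imp_differentiable[OF smooth_transition] assms by blast

lemma linear_transition_derivative:
  assumes "c \<in> A" "c' \<in> A" "x \<in> fst c" "x \<in> fst c'"
  shows "linear (frechet_derivative (transition c c') (at (snd c x)))"
  using transition_differentiable[OF assms] linear_frechet_derivative by blast

text \<open>The transformation law is the chain rule for the cocycle identity of three charts, valid
  on the coordinate image of their common domain. The lemma matters because nonnegativity and
  homogeneity of F are assumed only on \<open>tangent_space\<close>.\<close>

lemma tangent_of_in_tangent_space:
  assumes "c \<in> A" "x \<in> fst c"
  shows "tangent_of A c x y \<in> tangent_space A x"
proof -
  have chain: "frechet_derivative (transition c c'') (at (snd c x)) y =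
      frechet_derivative (transition c' c'') (at (snd c' x))
        (frechet_derivative (transition c c') (at (snd c x)) y)"
    if c: "c' \<in> A" "x \<in> fst c'" "c'' \<in> A" "x \<in> fst c''" for c' c''
  proof -
    let ?U = "snd c ` (fst c \<inter> fst c' \<inter> fst c'')"
    have "frechet_derivative (transition c c'') (at (snd c x)) =
        frechet_derivative (transition c' c'' \<circ> transition c c') (at (snd c x))"
    proof (rule frechet_derivative_transform_within_open)
      show "open ?U"
        using assms c by (intro open_chart_image open_Int open_chart_domain) auto
      show "snd c x \<in> ?U" using assms c by auto
    qed (use assms c transition_differentiable in \<open>auto simp: transition_chart\<close>)
    also have "\<dots> = frechet_derivative (transition c' c'') (at (transition c c' (snd c x))) \<circ>
        frechet_derivative (transition c c') (at (snd c x))"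
      using assms c by (intro frechet_derivative_compose)
        (auto simp: transition_chart intro: transition_differentiable)
    finally show ?thesis using assms by (simp add: transition_chart)
  qed
  have law: "tangent_of A c x y c'' =
      frechet_derivative (transition c' c'') (at (snd c' x)) (tangent_of A c x y c')"
    if "c' \<in> charts_at A x" "c'' \<in> charts_at A x" for c' c''
    using that chain[of c' c''] by (simp add: tangent_of_def charts_at_def)
  show ?thesis
    unfolding tangent_space_def
  proof (intro CollectI conjI ballI)
    show "tangent_of A c x y \<in> extensional (charts_at A x)"
      by (simp add: tangent_of_def)
  qed (rule law)
qed

lemma tangent_of_scale:
  assumes "c \<in> A" "x \<in> fst c"
  shows "tangent_of A c x (r *\<^sub>R y) = tangent_scale A x r (tangent_of A c x y)"
proof
  fix c'
  show "tangent_of A c x (r *\<^sub>R y) c' = tangent_scale A x r (tangent_of A c x y) c'"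
    using linear_cmul[OF linear_transition_derivative[of c c' x]] assms
    by (simp add: tangent_of_def tangent_scale_def charts_at_def restrict_def)
qed

lemma local_rep_chart:
  "c \<in> A \<Longrightarrow> x \<in> fst c \<Longrightarrow> local_rep A F c (snd c x, y) = F x (tangent_of A c x y)"
  by (simp add: local_rep_def chart_inv_chart)

lemma F_nonneg: "v \<in> tangent_space A x \<Longrightarrow> 0 \<le> F x v"
  and F_scale: "v \<in> tangent_space A x \<Longrightarrow> 0 \<le> r \<Longrightarrow> F x (tangent_scale A x r v) = r * F x v"
  using finsler_manifold unfolding finsler_manifold_def finsler_structure_def by blast+

lemma local_rep_nonneg:
  assumes "c \<in> A" "u \<in> snd c ` fst c"
  shows "0 \<le> local_rep A F c (u, y)"
  using assms F_nonneg[OF tangent_of_in_tangent_space[OF assms(1)]]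
  by (auto simp: local_rep_chart)

lemma local_rep_scale:
  assumes "c \<in> A" "u \<in> snd c ` fst c" "0 \<le> r"
  shows "local_rep A F c (u, r *\<^sub>R y) = r * local_rep A F c (u, y)"
  using assms F_scale[OF tangent_of_in_tangent_space[OF assms(1)]]
  by (auto simp: local_rep_chart tangent_of_scale)

lemma continuous_on_local_rep: "c \<in> A \<Longrightarrow> continuous_on (snd c ` fst c \<times> UNIV) (local_rep A F c)"
  and smooth_on_local_rep: "c \<in> A \<Longrightarrow> smooth_on (snd c ` fst c \<times> (UNIV - {0})) (local_rep A F c)"
  using finsler_manifold by (auto simp: finsler_manifold_def finsler_structure_def)

text \<open>Where \<open>F(u,\<cdot>)\<close> vanishes at \<open>y \<noteq> 0\<close>, it vanishes on the whole ray through \<open>y\<close>, so that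
  the fundamental tensor at \<open>y\<close> kills \<open>y\<close>.\<close>

lemma local_rep_pos:
  assumes c: "c \<in> A" "u \<in> snd c ` fst c" and "y \<noteq> 0"
  shows "0 < local_rep A F c (u, y)"
proof (rule ccontr)
  let ?f = "\<lambda>z. local_rep A F c (u, z)"
  let ?h = "\<lambda>z. 1 / 2 * (?f z)\<^sup>2"
  assume "\<not> ?thesis"
  with local_rep_nonneg[OF c, of y] have y0: "?f y = 0" by simp
  have bl: "bounded_linear (\<lambda>z::real^'n. (0::real^'n, z))"
    by (intro bounded_linear_Pair bounded_linear_zero bounded_linear_ident)
  have op: "open (UNIV - {0::real^'n})" by auto
  have "open (snd c ` fst c \<times> (UNIV - {0::real^'n}))"
    using open_Times[OF open_chart_range[OF c(1)] op] .
  from smooth_on_affine[OF this bl smooth_on_local_rep[OF c(1)], of "(u, 0)"]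
  have "smooth_on (UNIV - {0}) (\<lambda>z. local_rep A F c ((u, 0) + (0, z)))"
    by (rule smooth_on_subset) (use c in auto)
  then have sm: "smooth_on (UNIV - {0}) ?f" by simp
  let ?D = "\<lambda>z. frechet_derivative ?f (at z)"
  have df: "(?f has_derivative ?D z) (at z)" if "z \<noteq> 0" for z
    using smooth_on_imp_differentiable[OF sm, of z] that frechet_derivative_works by auto
  \<comment> \<open>Euler's relation on the ray: \<open>?f (s *\<^sub>R y)\<close> equals s times
    \<open>?f y\<close>, which is 0 for all s > 0, and its derivative at s = 1 is
    \<open>?D y y\<close>.\<close>
  have Dy: "?D y y = 0"
  proof -
    have "((\<lambda>s::real. s *\<^sub>R y) has_vector_derivative y) (at 1)"
      by (auto intro!: derivative_eq_intros)
    moreover have "?f differentiable (at (1 *\<^sub>R y))"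
      using smooth_on_imp_differentiable[OF sm, of y] \<open>y \<noteq> 0\<close> by simp
    ultimately have 1: "((\<lambda>s. ?f (s *\<^sub>R y)) has_vector_derivative ?D (1 *\<^sub>R y) y) (at 1)"
      by (rule has_vector_derivative_compose_frechet)
    have "((\<lambda>s. 0) has_vector_derivative ?D (1 *\<^sub>R y) y) (at 1)"
      by (rule has_vector_derivative_transform_within_open[OF 1, of "{0<..}"])
        (auto simp: local_rep_scale[OF c] y0)
    then show ?thesis
      using vector_derivative_at[of "\<lambda>_. 0" "?D (1 *\<^sub>R y) y" "1::real"] by simp
  qed
  have pd: "partial_deriv i ?h z = ?f z * ?D z (axis i 1)" if "z \<noteq> 0" for i z
  proof -
    have "(?h has_derivative (\<lambda>w. ?f z * ?D z w)) (at z)"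
      by (rule has_derivative_eq_rhs, rule derivative_intros | rule df[OF that] refl)+
        (auto simp: field_simps)
    from frechet_derivative_at[OF this] show ?thesis
      unfolding partial_deriv_def by metis
  qed
  have "(fundamental_tensor A F c u y *v y) $ i = 0" for i
  proof -
    define k where "k = partial_deriv i ?h"
    have "(\<lambda>z. ?D z (axis i 1)) differentiable (at y)"
      using smooth_on_imp_differentiable[OF smooth_on_frechet_derivative[OF sm]] \<open>y \<noteq> 0\<close> by simp
    then obtain E where E: "((\<lambda>z. ?D z (axis i 1)) has_derivative E) (at y)"
      by (auto simp: differentiable_def)
    \<comment> \<open>The second derivative \<open>E\<close> enters only with the factor
      \<open>?f y\<close>, which is 0. At y the Hessian of half the square is thus the rank-one form
      given by \<open>?D y\<close>, and \<open>?D y y = 0\<close> puts y in its kernel.\<close>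
    have "((\<lambda>z. ?f z * ?D z (axis i 1)) has_derivative (\<lambda>w. ?D y w * ?D y (axis i 1))) (at y)"
      using has_derivative_mult[OF df[OF \<open>y \<noteq> 0\<close>] E] by (simp add: y0)
    then have k: "(k has_derivative (\<lambda>w. ?D y w * ?D y (axis i 1))) (at y)"
      by (rule has_derivative_transform_within_open[OF _ op]) (use \<open>y \<noteq> 0\<close> pd in \<open>auto simp: k_def\<close>)
    have lin: "linear (frechet_derivative k (at y))"
      using k linear_frechet_derivative differentiable_def by blast
    have "(fundamental_tensor A F c u y *v y) $ i =
        (\<Sum>j\<in>UNIV. y $ j * frechet_derivative k (at y) (axis j 1))"
      unfolding matrix_vector_mult_def fundamental_tensor_def
      by (simp add: partial_deriv_def k_def mult.commute)
    also have "\<dots> = frechet_derivative k (at y) (\<Sum>j\<in>UNIV. y $ j *\<^sub>R axis j 1)"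
      by (simp add: linear_sum[OF lin] linear_cmul[OF lin])
    also have "(\<Sum>j\<in>UNIV. y $ j *\<^sub>R axis j 1) = y"
      using basis_expansion[of y] by (simp add: scalar_mult_eq_scaleR)
    also have "frechet_derivative k (at y) y = 0"
      by (simp add: frechet_derivative_at[OF k, symmetric] Dy)
    finally show ?thesis .
  qed
  then have "fundamental_tensor A F c u y *v y = 0" by (simp add: vec_eq_iff)
  moreover have "positive_definite (fundamental_tensor A F c u y)"
    using finsler_manifold c \<open>y \<noteq> 0\<close> unfolding finsler_manifold_def finsler_structure_def by blast
  ultimately show False
    using \<open>y \<noteq> 0\<close> unfolding positive_definite_def by (metis inner_zero_right less_irrefl)
qed

text \<open>m and M are the extrema of \<open>local_rep\<close> on the compact set K times the unit
  sphere; m > 0 by \<open>local_rep_pos\<close>. Writing y as \<open>norm y\<close> times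
  \<open>sgn y\<close> extends the bounds to all y, and this uses nonnegative factors only. For
  empty K there are no extrema, so that case is separate.\<close>

lemma local_rep_bounds:
  assumes "c \<in> A" "K \<subseteq> snd c ` fst c" "compact K"
  obtains m M where "0 < m" "0 < M"
    "\<And>u y. u \<in> K \<Longrightarrow> m * norm y \<le> local_rep A F c (u, y)"
    "\<And>u y. u \<in> K \<Longrightarrow> local_rep A F c (u, y) \<le> M * norm y"
proof (cases "K = {}")
  case True
  then show ?thesis using that[of 1 1] by auto
next
  case False
  let ?S = "K \<times> sphere (0::real^'n) 1"
  have S: "compact ?S" "?S \<noteq> {}"
    using assms False by (auto intro!: compact_Times)
  have cont: "continuous_on ?S (local_rep A F c)"
    using continuous_on_subset[OF continuous_on_local_rep] assms by blast
  obtain p where p: "p \<in> ?S" "\<And>q. q \<in> ?S \<Longrightarrow> local_rep A F c p \<le> local_rep A F c q"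
    using continuous_attains_inf[OF S cont] by blast
  obtain P where P: "P \<in> ?S" "\<And>q. q \<in> ?S \<Longrightarrow> local_rep A F c q \<le> local_rep A F c P"
    using continuous_attains_sup[OF S cont] by blast
  have pos: "0 < local_rep A F c q" if "q \<in> ?S" for q
      proof -
    have "fst q \<in> K" "snd q \<noteq> 0" using that by (auto simp: mem_Times_iff)
    then show ?thesis using local_rep_pos[OF assms(1), of "fst q" "snd q"] assms(2) by auto
  qed
  have *: "local_rep A F c p * norm y \<le> local_rep A F c (u, y)"
    "local_rep A F c (u, y) \<le> local_rep A F c P * norm y" if "u \<in> K" for u y
  proof -
    have eq: "local_rep A F c (u, y) = norm y * local_rep A F c (u, sgn y)"
    proof (cases "y = 0")
      case True
      then show ?thesis using local_rep_scale[OF assms(1), of u 0 0] that assms(2) by auto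
    next
      case False
      then show ?thesis
        using local_rep_scale[OF assms(1), of u "norm y" "sgn y"] that assms(2)
        by (auto simp: sgn_div_norm)
    qed
    have "(u, sgn y) \<in> ?S" if "y \<noteq> 0" using \<open>u \<in> K\<close> that by (simp add: norm_sgn)
    then show "local_rep A F c p * norm y \<le> local_rep A F c (u, y)"
      "local_rep A F c (u, y) \<le> local_rep A F c P * norm y"
      using p(2) P(2) eq by (cases "y = 0"; simp add: mult.commute mult_right_mono)+
  qed
  show ?thesis using that[of "local_rep A F c p" "local_rep A F c P"] * pos p(1) P(1) by blast
qed


section \<open>Speed and length of curves\<close>

lemma open_curve_vimage:
  "smooth_curve_on A J \<gamma> \<Longrightarrow> c \<in> A \<Longrightarrow> open (J \<inter> \<gamma> -` fst c)"
  unfolding smooth_curve_on_def using continuous_open_preimage open_chart_domain by blast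

text \<open>A smooth piece on a closed interval is given through an extension; this moves the
  smoothness to the curve itself on an open set where the two agree.\<close>

lemma smooth_curve_on_cong:
  assumes \<eta>: "smooth_curve_on A J \<eta>" and J: "open J'" "J' \<subseteq> J" "\<And>t. t \<in> J' \<Longrightarrow> \<eta> t = \<gamma> t"
  shows "smooth_curve_on A J' \<gamma>"
  unfolding smooth_curve_on_def
proof (intro conjI ballI)
  have "continuous_on J' \<eta>"
    using \<eta> J(2) continuous_on_subset unfolding smooth_curve_on_def by blast
  then show cont: "continuous_on J' \<gamma>" using J(3) by (simp cong: continuous_on_cong)
  fix c assume c: "c \<in> A"
  have o: "open (J' \<inter> \<gamma> -` fst c)"
    using continuous_open_preimage[OF cont J(1) open_chart_domain[OF c]] .
  have "smooth_on (J' \<inter> \<gamma> -` fst c) (snd c \<circ> \<eta>)"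
    by (rule smooth_on_subset[of "J \<inter> \<eta> -` fst c"]) (use \<eta> c J in \<open>auto simp: smooth_curve_on_def\<close>)
  then show "smooth_on (J' \<inter> \<gamma> -` fst c) (snd c \<circ> \<gamma>)"
    by (rule smooth_on_cong[OF o, rotated]) (use J in auto)
qed (rule J)

lemma smooth_curve_on_affine:
  assumes \<gamma>: "smooth_curve_on A J \<gamma>"
  shows "smooth_curve_on A ((\<lambda>t. s + r * t) -` J) (\<lambda>t. \<gamma> (s + r * t))"
  unfolding smooth_curve_on_def
proof (intro conjI ballI)
  have "continuous_on UNIV (\<lambda>t. s + r * t)" by (intro continuous_intros)
  then show "open ((\<lambda>t. s + r * t) -` J)"
    using \<gamma> by (simp add: smooth_curve_on_def open_vimage)
  have "continuous_on ((\<lambda>t. s + r * t) -` J) (\<lambda>t. s + r * t)" by (intro continuous_intros)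
  then show "continuous_on ((\<lambda>t. s + r * t) -` J) (\<lambda>t. \<gamma> (s + r * t))"
    using \<gamma> continuous_on_compose2[of J \<gamma> _ "\<lambda>t. s + r * t"] by (auto simp: smooth_curve_on_def)
  fix c assume c: "c \<in> A"
  have "smooth_on (J \<inter> \<gamma> -` fst c) (snd c \<circ> \<gamma>)"
    using \<gamma> c unfolding smooth_curve_on_def by blast
  from smooth_on_affine[OF open_curve_vimage[OF \<gamma> c] bounded_linear_mult_right this]
  have "smooth_on ((\<lambda>t. s + r * t) -` (J \<inter> \<gamma> -` fst c)) (\<lambda>t. (snd c \<circ> \<gamma>) (s + r * t))" .
  then show "smooth_on ((\<lambda>t. s + r * t) -` J \<inter> (\<lambda>t. \<gamma> (s + r * t)) -` fst c)
      (snd c \<circ> (\<lambda>t. \<gamma> (s + r * t)))"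
    by (rule back_subst[of "\<lambda>S. smooth_on S _", OF back_subst[of "\<lambda>g. smooth_on _ g"]]) auto
qed

lemma chart_curve_derivative:
  assumes \<gamma>: "smooth_curve_on A J \<gamma>" "t \<in> J" and c: "c \<in> A" "\<gamma> t \<in> fst c"
  shows "((\<lambda>s. snd c (\<gamma> s)) has_vector_derivative vector_derivative (snd c \<circ> \<gamma>) (at t)) (at t)"
proof -
  have "(snd c \<circ> \<gamma>) differentiable (at t)"
    using assms by (intro smooth_on_imp_differentiable[of "J \<inter> \<gamma> -` fst c"])
      (auto simp: smooth_curve_on_def)
  then show ?thesis by (simp add: vector_derivative_works o_def)
qed

definition speed :: "(real \<Rightarrow> 'm) \<Rightarrow> real \<Rightarrow> real" where
  "speed \<gamma> t = F (\<gamma> t) (velocity A \<gamma> t)"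

text \<open>By the chain rule the velocity components in any other chart are images of those in c
  under the derivative of the transition map. So the speed can be computed from
  \<open>local_rep\<close> in one chart of choice.\<close>

lemma velocity_chart:
  assumes \<gamma>: "smooth_curve_on A J \<gamma>" "t \<in> J" and c: "c \<in> A" "\<gamma> t \<in> fst c"
  shows "velocity A \<gamma> t = tangent_of A c (\<gamma> t) (vector_derivative (snd c \<circ> \<gamma>) (at t))"
proof -
  have "vector_derivative (snd c' \<circ> \<gamma>) (at t) =
      frechet_derivative (transition c c') (at (snd c (\<gamma> t))) (vector_derivative (snd c \<circ> \<gamma>) (at t))"
    (is "_ = ?v") if c': "c' \<in> A" "\<gamma> t \<in> fst c'" for c'
  proof (rule vector_derivative_at)
    have "((\<lambda>s. transition c c' (snd c (\<gamma> s))) has_vector_derivative ?v) (at t)"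
      using chart_curve_derivative[OF assms] transition_differentiable[OF c(1) c'(1) c(2) c'(2)]
      by (rule has_vector_derivative_compose_frechet)
    then show "(snd c' \<circ> \<gamma> has_vector_derivative ?v) (at t)"
      by (rule has_vector_derivative_transform_within_open[OF _ open_curve_vimage[OF \<gamma>(1) c(1)]])
        (use assms in \<open>auto simp: transition_chart\<close>)
  qed
  then show ?thesis
    unfolding velocity_def tangent_of_def by (intro restrict_ext) (auto simp: charts_at_def)
qed

lemma speed_chart:
  assumes "smooth_curve_on A J \<gamma>" "t \<in> J" "c \<in> A" "\<gamma> t \<in> fst c"
  shows "speed \<gamma> t = local_rep A F c (snd c (\<gamma> t), vector_derivative (snd c \<circ> \<gamma>) (at t))"
  using assms by (simp add: speed_def velocity_chart local_rep_chart)

lemma speed_cong: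
  assumes "open J" "t \<in> J" "\<And>s. s \<in> J \<Longrightarrow> \<gamma> s = \<eta> s"
  shows "speed \<gamma> t = speed \<eta> t"
proof -
  have "vector_derivative (snd c \<circ> \<gamma>) (at t) = vector_derivative (snd c \<circ> \<eta>) (at t)"
    for c :: "('m, 'n) chart"
    by (rule vector_derivative_cong_open[OF assms(1,2)]) (simp add: assms(3))
  then show ?thesis using assms by (simp add: speed_def velocity_def)
qed

lemma speed_nonneg:
  assumes "smooth_curve_on A J \<gamma>" "t \<in> J"
  shows "0 \<le> speed \<gamma> t"
proof -
  obtain c where "c \<in> A" "\<gamma> t \<in> fst c" using ex_chart by blast
  then show ?thesis using speed_chart[OF assms] local_rep_nonneg by simp
qed

text \<open>Continuity is local: the preimages of chart domains form an open cover of J, and on each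
  the speed is \<open>local_rep\<close> applied to position and coordinate velocity.\<close>

lemma continuous_on_speed:
  assumes \<gamma>: "smooth_curve_on A J \<gamma>"
  shows "continuous_on J (speed \<gamma>)"
proof -
  have "continuous_on (J \<inter> \<gamma> -` fst c) (speed \<gamma>)" if c: "c \<in> A" for c
  proof -
    let ?T = "J \<inter> \<gamma> -` fst c"
    have sm: "smooth_on ?T (snd c \<circ> \<gamma>)" using \<gamma> c by (auto simp: smooth_curve_on_def)
    have "continuous_on ?T (\<lambda>t. ((snd c \<circ> \<gamma>) t, vector_derivative (snd c \<circ> \<gamma>) (at t)))"
      by (intro continuous_on_Pair smooth_on_imp_continuous_on[OF sm]
          smooth_on_continuous_vector_derivative[OF sm])
    then have "continuous_on ?T
        (\<lambda>t. local_rep A F c ((snd c \<circ> \<gamma>) t, vector_derivative (snd c \<circ> \<gamma>) (at t)))"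
      by (rule continuous_on_compose2[OF continuous_on_local_rep[OF c]]) auto
    then show ?thesis
      by (rule continuous_on_eq) (use \<gamma> c in \<open>auto simp: speed_chart\<close>)
  qed
  then have "continuous_on (\<Union>c\<in>A. J \<inter> \<gamma> -` fst c) (speed \<gamma>)"
    by (intro continuous_on_open_UN open_curve_vimage[OF \<gamma>])
  moreover have "(\<Union>c\<in>A. J \<inter> \<gamma> -` fst c) = J" using ex_chart by auto
  ultimately show ?thesis by simp
qed

text \<open>The factor r must be nonnegative because F is only positively homogeneous: for r < 0 the
  reparametrized curve would be measured by F at the opposite vector.\<close>

lemma speed_affine:
  assumes \<gamma>: "smooth_curve_on A J \<gamma>" "s + r * t \<in> J" and r: "0 \<le> r"
  shows "speed (\<lambda>t. \<gamma> (s + r * t)) t = r * speed \<gamma> (s + r * t)"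
proof -
  obtain c where c: "c \<in> A" "\<gamma> (s + r * t) \<in> fst c" using ex_chart by blast
  let ?v = "vector_derivative (snd c \<circ> \<gamma>) (at (s + r * t))"
  have "((\<lambda>t. s + r * t) has_vector_derivative r) (at t)"
    by (auto intro!: derivative_eq_intros)
  from vector_diff_chain_at[OF this chart_curve_derivative[OF \<gamma> c]]
  have "vector_derivative (snd c \<circ> (\<lambda>t. \<gamma> (s + r * t))) (at t) = r *\<^sub>R ?v"
    by (intro vector_derivative_at) (simp add: o_def)
  then have "speed (\<lambda>t. \<gamma> (s + r * t)) t = local_rep A F c (snd c (\<gamma> (s + r * t)), r *\<^sub>R ?v)"
    using speed_chart[OF smooth_curve_on_affine[OF \<gamma>(1), of s r], of t c] \<gamma> c by simp
  also have "\<dots> = r * speed \<gamma> (s + r * t)"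
    using speed_chart[OF \<gamma> c] local_rep_scale[OF c(1) _ r] c by simp
  finally show ?thesis .
qed

section \<open>Regularity and length of piecewise smooth curves\<close>

lemma smooth_curve_on_Icc_cong:
  "smooth_curve_on_Icc A a b \<gamma> \<Longrightarrow> (\<And>t. t \<in> {a..b} \<Longrightarrow> \<gamma> t = \<eta> t) \<Longrightarrow> smooth_curve_on_Icc A a b \<eta>"
  unfolding smooth_curve_on_Icc_def by metis

lemma smooth_curve_on_Icc_affine:
  assumes "smooth_curve_on_Icc A (s + r * a) (s + r * b) \<gamma>" "0 \<le> r"
  shows "smooth_curve_on_Icc A a b (\<lambda>t. \<gamma> (s + r * t))"
proof -
  obtain J \<eta> where J: "{s + r * a..s + r * b} \<subseteq> J" "smooth_curve_on A J \<eta>"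
    "\<forall>t\<in>{s + r * a..s + r * b}. \<eta> t = \<gamma> t"
    using assms unfolding smooth_curve_on_Icc_def by blast
  have *: "s + r * t \<in> {s + r * a..s + r * b}" if "t \<in> {a..b}" for t
    using that assms(2) by (auto intro: mult_left_mono)
  show ?thesis
    unfolding smooth_curve_on_Icc_def
  proof (intro exI conjI ballI subsetI)
    show "smooth_curve_on A ((\<lambda>t. s + r * t) -` J) (\<lambda>t. \<eta> (s + r * t))"
      by (rule smooth_curve_on_affine[OF J(2)])
  qed (use * J(1,3) in blast)+
qed

text \<open>Smoothness of the curve itself on an open neighbourhood, not of an extension of one
  piece, so that the two-sided derivative in \<open>velocity\<close> is meaningful. Break points may
  fail it.\<close>

definition regular_at :: "(real \<Rightarrow> 'm) \<Rightarrow> real \<Rightarrow> bool" where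
  "regular_at \<gamma> t \<longleftrightarrow> (\<exists>J. t \<in> J \<and> smooth_curve_on A J \<gamma>)"

text \<open>The extension has continuous, hence integrable, speed; speed is local, so the two speeds
  can differ only at the end points, which do not affect integrability.\<close>

lemma smooth_curve_on_Icc_regular:
  assumes "smooth_curve_on_Icc A a b \<gamma>" "a < b"
  shows "continuous_on {a..b} \<gamma>" "t \<in> {a<..<b} \<Longrightarrow> regular_at \<gamma> t" "speed \<gamma> integrable_on {a..b}"
proof -
  obtain J \<eta> where J: "{a..b} \<subseteq> J" "smooth_curve_on A J \<eta>" "\<And>t. t \<in> {a..b} \<Longrightarrow> \<eta> t = \<gamma> t"
    using assms unfolding smooth_curve_on_Icc_def by blast
  have "continuous_on {a..b} \<eta>"
    using J continuous_on_subset unfolding smooth_curve_on_def by blast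
  then show "continuous_on {a..b} \<gamma>" by (rule continuous_on_eq) (rule J)
  have sm: "smooth_curve_on A {a<..<b} \<gamma>"
    by (rule smooth_curve_on_cong[OF J(2)]) (use J in auto)
  then show "t \<in> {a<..<b} \<Longrightarrow> regular_at \<gamma> t" unfolding regular_at_def by blast
  have "speed \<eta> integrable_on {a..b}"
    using continuous_on_subset[OF continuous_on_speed[OF J(2)] J(1)]
    by (rule integrable_continuous_real)
  then show "speed \<gamma> integrable_on {a..b}"
    by (rule integrable_spike_finite[of "{a, b}", rotated 2])
      (use speed_cong[of "{a<..<b}" _ \<gamma> \<eta>] J in auto)
qed

lemma piecewise_smooth_curve_regular:
  assumes "piecewise_smooth_curve A \<gamma>"
  shows "continuous_on {0..1} \<gamma>" "speed \<gamma> integrable_on {0..1}"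
    "\<exists>S. finite S \<and> (\<forall>t\<in>{0..1} - S. regular_at \<gamma> t)"
proof -
  obtain \<tau> :: "nat \<Rightarrow> real" and k where \<tau>: "\<tau> 0 = 0" "\<tau> k = 1"
    "\<And>i. i < k \<Longrightarrow> \<tau> i < \<tau> (Suc i) \<and> smooth_curve_on_Icc A (\<tau> i) (\<tau> (Suc i)) \<gamma>"
    using assms unfolding piecewise_smooth_curve_def by blast
  \<comment> \<open>Induction on the number of pieces; each new piece adds its two end points to the
    exceptional set.\<close>
  have "0 \<le> \<tau> i \<and> continuous_on {0..\<tau> i} \<gamma> \<and> speed \<gamma> integrable_on {0..\<tau> i} \<and>
      (\<exists>S. finite S \<and> (\<forall>t\<in>{0..\<tau> i} - S. regular_at \<gamma> t))" if "i \<le> k" for i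
    using that
  proof (induction i)
    case 0
    have "\<exists>S. finite S \<and> (\<forall>t\<in>{0} - S. regular_at \<gamma> t)" by (intro exI[of _ "{0}"]) auto
    then show ?case using \<tau>(1) by (auto intro: integrable_on_refl[of _ 0, simplified])
  next
    case (Suc i)
    then obtain S where i: "0 \<le> \<tau> i" "continuous_on {0..\<tau> i} \<gamma>" "speed \<gamma> integrable_on {0..\<tau> i}"
      and S: "finite S" "\<forall>t\<in>{0..\<tau> i} - S. regular_at \<gamma> t" by auto
    have lt: "\<tau> i < \<tau> (Suc i)" and sm: "smooth_curve_on_Icc A (\<tau> i) (\<tau> (Suc i)) \<gamma>"
      using \<tau>(3)[of i] Suc.prems by auto
    note piece = smooth_curve_on_Icc_regular[OF sm lt]
    have "continuous_on ({0..\<tau> i} \<union> {\<tau> i..\<tau> (Suc i)}) \<gamma>"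
      using i(2) piece(1) by (intro continuous_on_closed_Un) auto
    also have "{0..\<tau> i} \<union> {\<tau> i..\<tau> (Suc i)} = {0..\<tau> (Suc i)}" using i(1) lt by auto
    finally have "continuous_on {0..\<tau> (Suc i)} \<gamma>" .
    moreover have "speed \<gamma> integrable_on {0..\<tau> (Suc i)}"
      using Henstock_Kurzweil_Integration.integrable_combine[OF i(1) _ i(3) piece(3)] lt by simp
    moreover have "\<exists>S. finite S \<and> (\<forall>t\<in>{0..\<tau> (Suc i)} - S. regular_at \<gamma> t)"
    proof (intro exI[of _ "S \<union> {\<tau> i, \<tau> (Suc i)}"] conjI ballI)
      fix t assume "t \<in> {0..\<tau> (Suc i)} - (S \<union> {\<tau> i, \<tau> (Suc i)})"
      then show "regular_at \<gamma> t" using S(2) piece(2)[of t] by (cases "t \<le> \<tau> i") auto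
    qed (use S(1) in simp)
    moreover have "0 \<le> \<tau> (Suc i)" using i(1) lt by simp
    ultimately show ?case by blast
  qed
  from this[of k] \<tau>(2) show "continuous_on {0..1} \<gamma>" "speed \<gamma> integrable_on {0..1}"
    "\<exists>S. finite S \<and> (\<forall>t\<in>{0..1} - S. regular_at \<gamma> t)" by simp_all
qed

lemma finsler_length_has_integral:
  "piecewise_smooth_curve A \<gamma> \<Longrightarrow> (speed \<gamma> has_integral finsler_length A F \<gamma>) {0..1}"
  using piecewise_smooth_curve_regular(2)
  by (simp add: finsler_length_def speed_def[abs_def] has_integral_integral)

text \<open>At an exceptional time \<open>velocity\<close> need not be a tangent vector, so F may
  take any value there. Overwriting the integrand by 0 at these finitely many times leaves the
  integral unchanged.\<close>

lemma finsler_length_nonneg: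
  assumes "piecewise_smooth_curve A \<gamma>"
  shows "0 \<le> finsler_length A F \<gamma>"
proof -
  obtain S where S: "finite S" "\<forall>t\<in>{0..1} - S. regular_at \<gamma> t"
    using piecewise_smooth_curve_regular[OF assms] by blast
  have "((\<lambda>t. if t \<in> S then 0 else speed \<gamma> t) has_integral finsler_length A F \<gamma>) {0..1}"
    by (rule has_integral_spike_finite[OF S(1) _ finsler_length_has_integral[OF assms]]) auto
  then show ?thesis
    by (rule has_integral_nonneg) (use S(2) in \<open>auto simp: regular_at_def intro: speed_nonneg\<close>)
qed

section \<open>Concatenation of curves\<close>

lemma partition_mono:
  fixes \<tau> :: "nat \<Rightarrow> real"
  assumes "\<And>i. i < k \<Longrightarrow> \<tau> i < \<tau> (Suc i)" "i \<le> j" "j \<le> k"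
  shows "\<tau> i \<le> \<tau> j"
  using assms(2,3)
proof (induction j rule: dec_induct)
  case (step j)
  then show ?case using assms(1)[of j] by simp
qed simp

lemma piecewise_smooth_curve_join:
  assumes \<gamma>1: "piecewise_smooth_curve A \<gamma>1" and \<gamma>2: "piecewise_smooth_curve A \<gamma>2"
    and join: "\<gamma>1 1 = \<gamma>2 0"
  shows "piecewise_smooth_curve A (\<gamma>1 +++ \<gamma>2)"
proof -
  obtain \<tau>1 :: "nat \<Rightarrow> real" and k1 where \<tau>1: "\<tau>1 0 = 0" "\<tau>1 k1 = 1"
    "\<And>i. i < k1 \<Longrightarrow> \<tau>1 i < \<tau>1 (Suc i)"
    "\<And>i. i < k1 \<Longrightarrow> smooth_curve_on_Icc A (\<tau>1 i) (\<tau>1 (Suc i)) \<gamma>1"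
    using \<gamma>1 unfolding piecewise_smooth_curve_def by blast
  obtain \<tau>2 :: "nat \<Rightarrow> real" and k2 where \<tau>2: "\<tau>2 0 = 0" "\<tau>2 k2 = 1"
    "\<And>i. i < k2 \<Longrightarrow> \<tau>2 i < \<tau>2 (Suc i)"
    "\<And>i. i < k2 \<Longrightarrow> smooth_curve_on_Icc A (\<tau>2 i) (\<tau>2 (Suc i)) \<gamma>2"
    using \<gamma>2 unfolding piecewise_smooth_curve_def by blast
  \<comment> \<open>The first partition is squeezed into [0, 1/2] and the second into [1/2, 1]. At i
    = k1 both formulas give 1/2, hence \<open>\<tau>_left\<close> includes that index.\<close>
  define \<tau> where "\<tau> i = (if i < k1 then \<tau>1 i / 2 else 1 / 2 + \<tau>2 (i - k1) / 2)" for i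
  have \<tau>_left: "\<tau> i = \<tau>1 i / 2" if "i \<le> k1" for i
    using that \<tau>1(2) \<tau>2(1) by (cases "i = k1") (auto simp: \<tau>_def)
  have "\<tau> i < \<tau> (Suc i) \<and> smooth_curve_on_Icc A (\<tau> i) (\<tau> (Suc i)) (\<gamma>1 +++ \<gamma>2)"
    if i: "i < k1 + k2" for i
  proof (cases "i < k1")
    case True
    have "smooth_curve_on_Icc A (\<tau> i) (\<tau> (Suc i)) (\<lambda>t. \<gamma>1 (0 + 2 * t))"
      by (rule smooth_curve_on_Icc_affine) (use \<tau>1(4)[OF True] True in \<open>simp_all add: \<tau>_left\<close>)
    moreover have "\<tau>1 (Suc i) \<le> 1"
      using partition_mono[of k1 \<tau>1 "Suc i" k1] \<tau>1 True by simp
    ultimately have "smooth_curve_on_Icc A (\<tau> i) (\<tau> (Suc i)) (\<gamma>1 +++ \<gamma>2)"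
      by (rule_tac smooth_curve_on_Icc_cong) (use True in \<open>auto simp: joinpaths_def \<tau>_left\<close>)
    then show ?thesis using \<tau>1(3)[OF True] True by (simp add: \<tau>_left)
  next
    case False
    define j where "j = i - k1"
    have j: "i = k1 + j" "j < k2" using False i by (auto simp: j_def)
    have "smooth_curve_on_Icc A (\<tau> i) (\<tau> (Suc i)) (\<lambda>t. \<gamma>2 (-1 + 2 * t))"
      by (rule smooth_curve_on_Icc_affine) (use \<tau>2(4)[OF j(2)] in \<open>simp_all add: \<tau>_def j(1)\<close>)
    \<comment> \<open>At t = 1/2 the concatenation still follows \<open>\<gamma>1\<close>, so the
      matching condition \<open>join\<close> enters exactly there.\<close>
    moreover have "\<gamma>2 (-1 + 2 * t) = (\<gamma>1 +++ \<gamma>2) t" if "t \<in> {\<tau> i..\<tau> (Suc i)}" for t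
    proof (cases "t = 1 / 2")
      case True
      show ?thesis unfolding True using join by (simp add: joinpaths_def)
    next
      case False
      have "0 \<le> \<tau>2 j"
        using partition_mono[of k2 \<tau>2 0 j] \<tau>2 \<open>j < k2\<close> by simp
      then show ?thesis using that False by (auto simp: joinpaths_def \<tau>_def j)
    qed
    ultimately have "smooth_curve_on_Icc A (\<tau> i) (\<tau> (Suc i)) (\<gamma>1 +++ \<gamma>2)"
      by (rule smooth_curve_on_Icc_cong)
    then show ?thesis using \<tau>2(3)[OF j(2)] by (simp add: \<tau>_def j)
  qed
  moreover have "\<tau> 0 = 0" using \<tau>1 by (simp add: \<tau>_left)
  moreover have "\<tau> (k1 + k2) = 1" using \<tau>2 by (simp add: \<tau>_def)
  ultimately show ?thesis unfolding piecewise_smooth_curve_def by blast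
qed

text \<open>The factor r from the speed cancels the factor 1/r from the change of variables.
  Agreement on the open interval suffices: the end points and the preimages of the exceptional times
  form a finite set.\<close>

lemma speed_affine_has_integral:
  assumes \<gamma>: "piecewise_smooth_curve A \<gamma>" and r: "0 < r" and ab: "s + r * a = 0" "s + r * b = 1"
    and eq: "\<And>t. t \<in> {a<..<b} \<Longrightarrow> \<eta> t = \<gamma> (s + r * t)"
  shows "(speed \<eta> has_integral finsler_length A F \<gamma>) {a..b}"
proof -
  obtain S where S: "finite S" "\<forall>t\<in>{0..1} - S. regular_at \<gamma> t"
    using piecewise_smooth_curve_regular[OF \<gamma>] by blast
  have ab': "a = (0 - s) / r" "b = (1 - s) / r" using r ab by (simp_all add: field_simps)
  have "((\<lambda>t. speed \<gamma> (r *\<^sub>R t + s)) has_integral finsler_length A F \<gamma> /\<^sub>R r ^ DIM(real))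
      (cbox ((0 - s) /\<^sub>R r) ((1 - s) /\<^sub>R r))"
    using finsler_length_has_integral[OF \<gamma>] r by (intro has_integral_affinity') auto
  then have "((\<lambda>t. speed \<gamma> (s + r * t)) has_integral finsler_length A F \<gamma> / r) {a..b}"
    by (simp add: ab' field_simps add.commute)
  from has_integral_mult_right[OF this, of r]
  have I: "((\<lambda>t. r * speed \<gamma> (s + r * t)) has_integral finsler_length A F \<gamma>) {a..b}"
    using r by simp
  have fin: "finite ({a, b} \<union> (\<lambda>x. (x - s) / r) ` S)" using S(1) by simp
  show ?thesis
  proof (rule has_integral_spike_finite[OF fin _ I])
    fix t assume t: "t \<in> {a..b} - ({a, b} \<union> (\<lambda>x. (x - s) / r) ` S)"
    have "r * a \<le> r * t" "r * t \<le> r * b" using t r by auto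
    then have "0 \<le> s + r * t" "s + r * t \<le> 1" using ab by linarith+
    moreover have "s + r * t \<notin> S"
    proof
      assume "s + r * t \<in> S"
      from imageI[OF this, of "\<lambda>x. (x - s) / r"] t r show False by simp
    qed
    ultimately obtain J where J: "s + r * t \<in> J" "smooth_curve_on A J \<gamma>"
      using S(2) unfolding regular_at_def by (meson DiffI atLeastAtMost_iff)
    have "speed \<eta> t = speed (\<lambda>t. \<gamma> (s + r * t)) t"
      using t eq by (intro speed_cong[of "{a<..<b}"]) auto
    then show "speed \<eta> t = r * speed \<gamma> (s + r * t)"
      using speed_affine[OF J(2,1)] r by simp
  qed
qed

lemma finsler_length_join:
  assumes "piecewise_smooth_curve A \<gamma>1" "piecewise_smooth_curve A \<gamma>2"
  shows "finsler_length A F (\<gamma>1 +++ \<gamma>2) = finsler_length A F \<gamma>1 + finsler_length A F \<gamma>2"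
proof -
  have "(speed (\<gamma>1 +++ \<gamma>2) has_integral finsler_length A F \<gamma>1) {0..1/2}"
    by (rule speed_affine_has_integral[OF assms(1), of 2 0]) (auto simp: joinpaths_def)
  moreover have "(speed (\<gamma>1 +++ \<gamma>2) has_integral finsler_length A F \<gamma>2) {1/2..1}"
    by (rule speed_affine_has_integral[OF assms(2), of 2 "-1"]) (auto simp: joinpaths_def)
  ultimately have "(speed (\<gamma>1 +++ \<gamma>2) has_integral
      (finsler_length A F \<gamma>1 + finsler_length A F \<gamma>2)) {0..1}"
    by (rule has_integral_combine[rotated 2]) auto
  then show ?thesis
    by (simp add: finsler_length_def speed_def[abs_def] integral_unique)
qed


section \<open>Local comparison of the distance with a chart\<close>

text \<open>The curve is the straight segment in coordinates, with constant coordinate velocity v -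
  u. In another chart it is a transition map after an affine map, hence smooth.\<close>

lemma chart_segment:
  assumes c: "c \<in> A" and B: "convex B" "B \<subseteq> snd c ` fst c" "u \<in> B" "v \<in> B"
    and M: "\<And>w y. w \<in> B \<Longrightarrow> local_rep A F c (w, y) \<le> M * norm y"
  shows "\<exists>\<gamma>. piecewise_smooth_curve A \<gamma> \<and> \<gamma> 0 = chart_inv c u \<and> \<gamma> 1 = chart_inv c v \<and>
    finsler_length A F \<gamma> \<le> M * norm (v - u)"
proof -
  let ?l = "\<lambda>t::real. u + t *\<^sub>R (v - u)"
  let ?\<gamma> = "\<lambda>t. chart_inv c (?l t)"
  \<comment> \<open>All times at which the line lies in the chart range: an open set containing
    [0, 1], which supplies the extension beyond the end points.\<close>
  let ?J = "?l -` (snd c ` fst c)"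
  have l: "?l t \<in> B" if "t \<in> {0..1}" for t
  proof -
    have "?l t = (1 - t) *\<^sub>R u + t *\<^sub>R v" by (simp add: algebra_simps)
    then show ?thesis using that B by (simp add: convexD_alt)
  qed
  have cont: "continuous_on S ?l" for S by (intro continuous_intros)
  have J: "open ?J" using open_chart_range[OF c] cont[of UNIV] by (simp add: open_vimage)
  have sm: "smooth_curve_on A ?J ?\<gamma>"
    unfolding smooth_curve_on_def
  proof (intro conjI ballI J)
    show "continuous_on ?J ?\<gamma>"
      by (rule continuous_on_compose2[OF continuous_on_chart_inv[OF c] cont]) auto
    fix c' assume c': "c' \<in> A"
    have "open (snd c ` (fst c \<inter> fst c'))"
      using c c' by (intro open_chart_image open_Int open_chart_domain) auto
    from smooth_on_affine[OF this bounded_linear_scaleR_left smooth_transition[OF c c'], of u "v - u"]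
    have "smooth_on (?l -` (snd c ` (fst c \<inter> fst c'))) (snd c' \<circ> ?\<gamma>)"
      by (simp add: transition_def o_def)
    moreover have "?J \<inter> ?\<gamma> -` fst c' \<subseteq> ?l -` (snd c ` (fst c \<inter> fst c'))"
      using chart_chart_inv[OF c] chart_inv_in[OF c] by (auto intro!: rev_image_eqI simp: chart_inv_chart[OF c])
    ultimately show "smooth_on (?J \<inter> ?\<gamma> -` fst c') (snd c' \<circ> ?\<gamma>)"
      using smooth_on_subset by blast
  qed
  have sub: "{0..1} \<subseteq> ?J"
  proof (rule subsetI)
    fix t :: real assume "t \<in> {0..1}"
    then show "t \<in> ?J" using l[of t] B(2) by blast
  qed
  have pw: "piecewise_smooth_curve A ?\<gamma>"
    unfolding piecewise_smooth_curve_def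
  proof (intro exI[of _ real] exI[of _ "1::nat"] conjI allI impI)
    show "real 0 = 0" "real 1 = 1" by simp_all
    fix i :: nat assume "i < 1"
    then have "i = 0" by simp
    show "real i < real (Suc i)" by simp
    show "smooth_curve_on_Icc A (real i) (real (Suc i)) ?\<gamma>"
      unfolding smooth_curve_on_Icc_def \<open>i = 0\<close>
      using sm sub by (intro exI[of _ ?J] exI[of _ ?\<gamma>]) simp
  qed
  have sp: "speed ?\<gamma> t = local_rep A F c (?l t, v - u)" if t: "t \<in> ?J" for t
  proof -
    have "(?l has_vector_derivative (v - u)) (at t)"
      by (auto intro!: derivative_eq_intros)
    then have "(snd c \<circ> ?\<gamma> has_vector_derivative (v - u)) (at t)"
      by (rule has_vector_derivative_transform_within_open[OF _ J t])
        (use c in \<open>auto simp: chart_chart_inv\<close>)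
    then have "vector_derivative (snd c \<circ> ?\<gamma>) (at t) = v - u" by (rule vector_derivative_at)
    then show ?thesis
      using speed_chart[OF sm t c] t chart_inv_in[OF c] chart_chart_inv[OF c] by simp
  qed
  have "finsler_length A F ?\<gamma> \<le> M * norm (v - u)"
  proof (rule has_integral_le[OF finsler_length_has_integral[OF pw]])
    show "((\<lambda>t. M * norm (v - u)) has_integral M * norm (v - u)) {0..1::real}"
      using has_integral_const_real[of "M * norm (v - u)" 0 1] by simp
    fix t :: real assume t: "t \<in> {0..1}"
    then show "speed ?\<gamma> t \<le> M * norm (v - u)" using sp[of t] M[OF l[OF t]] sub by auto
  qed
  then show ?thesis using pw by (intro exI[of _ ?\<gamma>]) simp
qed

text \<open>Compactness of the closed ball makes m and M uniform. The radius is chosen inside the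
  image of the part of the domain lying in V; injectivity of the chart brings points of the ball
  back into V.\<close>

lemma chart_ball:
  assumes "open V" "x \<in> V"
  obtains c R m M where "c \<in> A" "x \<in> fst c" "0 < R" "cball (snd c x) R \<subseteq> snd c ` fst c"
    "\<And>y. y \<in> fst c \<Longrightarrow> snd c y \<in> cball (snd c x) R \<Longrightarrow> y \<in> V" "0 < m" "0 < M"
    "\<And>u y. u \<in> cball (snd c x) R \<Longrightarrow> m * norm y \<le> local_rep A F c (u, y)"
    "\<And>u y. u \<in> cball (snd c x) R \<Longrightarrow> local_rep A F c (u, y) \<le> M * norm y"
proof -
  obtain c where c: "c \<in> A" "x \<in> fst c" using ex_chart by blast
  have "open (snd c ` (fst c \<inter> V))"
    using c assms by (intro open_chart_image open_Int open_chart_domain) auto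
  then obtain R where R: "0 < R" "cball (snd c x) R \<subseteq> snd c ` (fst c \<inter> V)"
    using open_contains_cball c(2) assms(2) by (metis IntI imageI)
  then have sub: "cball (snd c x) R \<subseteq> snd c ` fst c" by blast
  have V: "y \<in> V" if y: "y \<in> fst c" "snd c y \<in> cball (snd c x) R" for y
  proof -
    obtain z where "z \<in> fst c" "z \<in> V" "snd c y = snd c z" using y R(2) by blast
    then show ?thesis using chart_inv_chart[OF c(1)] y(1) by metis
  qed
  obtain m M where "0 < m" "0 < M"
    "\<And>u y. u \<in> cball (snd c x) R \<Longrightarrow> m * norm y \<le> local_rep A F c (u, y)"
    "\<And>u y. u \<in> cball (snd c x) R \<Longrightarrow> local_rep A F c (u, y) \<le> M * norm y"
    using local_rep_bounds[OF c(1) sub compact_cball] by blast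
  then show ?thesis using that c R(1) sub V by blast
qed

text \<open>This makes the set of lengths in \<open>finsler_dist\<close> nonempty, so that its
  infimum is meaningful and can be bounded below.\<close>

lemma reachable: "\<exists>\<gamma>. piecewise_smooth_curve A \<gamma> \<and> \<gamma> 0 = p \<and> \<gamma> 1 = q"
proof -
  define R where "R p q \<longleftrightarrow> (\<exists>\<gamma>. piecewise_smooth_curve A \<gamma> \<and> \<gamma> 0 = p \<and> \<gamma> 1 = q)" for p q
  have trans: "R x z" if xy: "R x y" and yz: "R y z" for x y z
  proof -
    obtain \<gamma>1 \<gamma>2 where \<gamma>: "piecewise_smooth_curve A \<gamma>1" "\<gamma>1 0 = x" "\<gamma>1 1 = y"
      "piecewise_smooth_curve A \<gamma>2" "\<gamma>2 0 = y" "\<gamma>2 1 = z"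
      using xy yz unfolding R_def by blast
    then have "piecewise_smooth_curve A (\<gamma>1 +++ \<gamma>2)" by (intro piecewise_smooth_curve_join) auto
    moreover have "(\<gamma>1 +++ \<gamma>2) 0 = x" "(\<gamma>1 +++ \<gamma>2) 1 = z" using \<gamma> by (auto simp: joinpaths_def)
    ultimately show ?thesis unfolding R_def by blast
  qed
  have "connected (UNIV :: 'm set)" using finsler_manifold by (simp add: finsler_manifold_def)
  then have "R p q \<and> R q p"
  \<comment> \<open>Demanding both directions makes the relation symmetric without reversing curves;
    locally both are given by coordinate segments.\<close>
  proof (rule connected_equivalence_relation[where R = "\<lambda>x y. R x y \<and> R y x"])
    fix x :: 'm
    obtain c e m M where c: "c \<in> A" "x \<in> fst c" and e: "0 < e" "cball (snd c x) e \<subseteq> snd c ` fst c"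
      and M: "\<And>u y. u \<in> cball (snd c x) e \<Longrightarrow> local_rep A F c (u, y) \<le> M * norm y"
      using chart_ball[of UNIV x] by (metis open_UNIV UNIV_I)
    let ?T = "fst c \<inter> snd c -` ball (snd c x) e"
    have "R y z" if "y \<in> ?T" "z \<in> ?T" for y z
      using chart_segment[OF c(1) convex_cball e(2) _ _ M, of "snd c y" "snd c z"] that c(1)
      unfolding R_def by (auto simp: chart_inv_chart)
    moreover have "open ?T" "x \<in> ?T" using c e by (auto intro: open_chart_vimage)
    ultimately show "\<exists>T. openin (top_of_set UNIV) T \<and> x \<in> T \<and> (\<forall>y\<in>T. R x y \<and> R y x)"
      by (intro exI[of _ ?T]) auto
  qed (auto intro: trans)
  then show ?thesis by (simp add: R_def)
qed

section \<open>The distance as an infimum and lower bounds for lengths\<close>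

abbreviation d :: "'m \<Rightarrow> 'm \<Rightarrow> real" where "d \<equiv> finsler_dist A F"

lemma dist_le_length: "piecewise_smooth_curve A \<gamma> \<Longrightarrow> d (\<gamma> 0) (\<gamma> 1) \<le> finsler_length A F \<gamma>"
  unfolding finsler_dist_def using finsler_length_nonneg
  by (intro cInf_lower bdd_belowI[of _ 0]) auto

lemma dist_ge:
  assumes "\<And>\<gamma>. piecewise_smooth_curve A \<gamma> \<Longrightarrow> \<gamma> 0 = p \<Longrightarrow> \<gamma> 1 = q \<Longrightarrow> l \<le> finsler_length A F \<gamma>"
  shows "l \<le> d p q"
  unfolding finsler_dist_def using reachable[of p q] assms by (intro cInf_greatest) auto

lemma dist_triangle_finsler: "d p r \<le> d p q + d q r"
proof -
  \<comment> \<open>Subtracting the other distance lets the two infima be handled one at a time by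
    \<open>dist_ge\<close>.\<close>
  have "d p r - d q r \<le> d p q"
  proof (rule dist_ge)
    fix \<gamma>1 assume \<gamma>1: "piecewise_smooth_curve A \<gamma>1" "\<gamma>1 0 = p" "\<gamma>1 1 = q"
    have "d p r - finsler_length A F \<gamma>1 \<le> d q r"
    proof (rule dist_ge)
      fix \<gamma>2 assume \<gamma>2: "piecewise_smooth_curve A \<gamma>2" "\<gamma>2 0 = q" "\<gamma>2 1 = r"
      have "d ((\<gamma>1 +++ \<gamma>2) 0) ((\<gamma>1 +++ \<gamma>2) 1) \<le> finsler_length A F (\<gamma>1 +++ \<gamma>2)"
        using \<gamma>1 \<gamma>2 by (intro dist_le_length piecewise_smooth_curve_join) auto
      then show "d p r - finsler_length A F \<gamma>1 \<le> finsler_length A F \<gamma>2"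
        using \<gamma>1 \<gamma>2 finsler_length_join by (simp add: joinpaths_def)
    qed
    then show "d p r - d q r \<le> finsler_length A F \<gamma>1" by simp
  qed
  then show ?thesis by simp
qed

text \<open>The coordinate displacement is the integral of the coordinate velocity, and m times the
  norm of the latter is at most the speed. A subinterval is allowed because a curve may stay in K
  for part of the time only.\<close>

lemma length_ge_chart:
  assumes \<gamma>: "piecewise_smooth_curve A \<gamma>" and st: "0 \<le> s" "s \<le> t" "t \<le> 1"
    and c: "c \<in> A" "\<And>r. r \<in> {s..t} \<Longrightarrow> \<gamma> r \<in> fst c \<and> snd c (\<gamma> r) \<in> K"
    and m: "0 < m" "\<And>u y. u \<in> K \<Longrightarrow> m * norm y \<le> local_rep A F c (u, y)"
  shows "m * norm (snd c (\<gamma> t) - snd c (\<gamma> s)) \<le> finsler_length A F \<gamma>"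
proof -
  obtain S where S: "finite S" "\<And>t. t \<in> {0..1} - S \<Longrightarrow> regular_at \<gamma> t"
    using piecewise_smooth_curve_regular[OF \<gamma>] by blast
  let ?f = "\<lambda>r. if r \<in> S then 0 else vector_derivative (snd c \<circ> \<gamma>) (at r)"
  let ?g = "\<lambda>r. if r \<in> S then 0 else speed \<gamma> r"
  have g: "(?g has_integral finsler_length A F \<gamma>) {0..1}"
    by (rule has_integral_spike_finite[OF S(1) _ finsler_length_has_integral[OF \<gamma>]]) auto
  have g_nonneg: "0 \<le> ?g r" if "r \<in> {0..1}" for r
    using S(2)[of r] that speed_nonneg by (auto simp: regular_at_def)
  have sub: "{s..t} \<subseteq> {0..1}" using st by auto
  have g_int: "?g integrable_on {s..t}"
    using integrable_on_subinterval[OF has_integral_integrable[OF g] sub] .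
  have "continuous_on {s..t} \<gamma>"
    using continuous_on_subset[OF piecewise_smooth_curve_regular(1)[OF \<gamma>] sub] .
  then have "continuous_on {s..t} (\<lambda>r. snd c (\<gamma> r))"
    by (rule continuous_on_compose2[OF continuous_on_chart[OF c(1)]]) (use c(2) in auto)
  then have f: "(?f has_integral (snd c (\<gamma> t) - snd c (\<gamma> s))) {s..t}"
  \<comment> \<open>Continuity on the closed interval bridges the finitely many times without a
    derivative.\<close>
  proof (rule fundamental_theorem_of_calculus_interior_strong[OF S(1) st(2), rotated])
    fix r assume r: "r \<in> {s<..<t} - S"
    then have "regular_at \<gamma> r" using S(2) st by simp
    then obtain J where "smooth_curve_on A J \<gamma>" "r \<in> J" unfolding regular_at_def by blast
    then show "((\<lambda>r. snd c (\<gamma> r)) has_vector_derivative ?f r) (at r)"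
      using chart_curve_derivative[of J \<gamma> r c] c r by simp
  qed
  have le: "norm (m *\<^sub>R ?f r) \<le> ?g r" if r: "r \<in> {s..t}" for r
  proof (cases "r \<in> S")
    case False
    then have "regular_at \<gamma> r" using S(2) r sub by blast
    then obtain J where J: "smooth_curve_on A J \<gamma>" "r \<in> J" unfolding regular_at_def by blast
    show ?thesis
      using speed_chart[OF J c(1)] c(2)[OF r] m False by simp
  qed simp
  have "norm (integral {s..t} (\<lambda>r. m *\<^sub>R ?f r)) \<le> integral {s..t} ?g"
    by (rule Henstock_Kurzweil_Integration.integral_norm_bound_integral[OF _ g_int le])
      (use has_integral_integrable[OF has_integral_cmul[OF f]] in auto)
  also have "integral {s..t} ?g \<le> integral {0..1} ?g"
    using g_nonneg by (intro integral_subset_le sub g_int has_integral_integrable[OF g]) auto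
  also have "integral {0..1} ?g = finsler_length A F \<gamma>" by (rule integral_unique[OF g])
  also have "integral {s..t} (\<lambda>r. m *\<^sub>R ?f r) = m *\<^sub>R (snd c (\<gamma> t) - snd c (\<gamma> s))"
    by (rule integral_unique[OF has_integral_cmul[OF f]])
  finally show ?thesis using m(1) by simp
qed

text \<open>s is the first time outside the open coordinate ball. The point to settle is that the
  curve has not left the chart domain at time s, so that its exit point has coordinates on the
  sphere.\<close>

lemma chart_ball_exit:
  fixes \<delta> :: "real \<Rightarrow> 'm"
  assumes \<delta>: "continuous_on {0..1} \<delta>" and c: "c \<in> A" "cball u R \<subseteq> snd c ` fst c"
    and start: "\<delta> 0 \<in> fst c" "snd c (\<delta> 0) \<in> ball u R"
    and exit: "t \<in> {0..1}" "\<not> (\<delta> t \<in> fst c \<and> snd c (\<delta> t) \<in> ball u R)"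
  obtains s where "s \<in> {0..1}" "dist u (snd c (\<delta> s)) = R"
    "\<And>r. r \<in> {0..s} \<Longrightarrow> \<delta> r \<in> fst c \<and> snd c (\<delta> r) \<in> cball u R"
proof -
  let ?X = "fst c \<inter> snd c -` ball u R"
  let ?K = "chart_inv c ` cball u R"
  let ?T = "{0..1} \<inter> \<delta> -` (- ?X)"
  have "closed (- ?X)"
    using open_chart_vimage[OF c(1) open_ball] by (simp only: open_closed)
  then have T: "closed ?T" by (rule continuous_closed_preimage[OF \<delta> closed_atLeastAtMost])
  have T_ne: "?T \<noteq> {}" and T_bdd: "bdd_below ?T" using exit by (auto intro: bdd_belowI[of _ 0])
  define s where "s = Inf ?T"
  have s: "s \<in> ?T" unfolding s_def by (rule closed_contains_Inf[OF T_ne T_bdd T])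
  have before: "\<delta> r \<in> ?X" if "0 \<le> r" "r < s" for r
    using that s cInf_lower[OF _ T_bdd, of r] unfolding s_def by fastforce
  \<comment> \<open>The closed coordinate ball is compact in M, hence closed since M is Hausdorff.
    The curve is in it before s, so by continuity also at s; not being in the open ball then forces
    distance exactly R.\<close>
  have "compact ?K"
    using c by (intro compact_continuous_image continuous_on_subset[OF continuous_on_chart_inv]) auto
  then have "closed ({0..s} \<inter> \<delta> -` ?K)"
    using s by (intro continuous_closed_preimage continuous_on_subset[OF \<delta>] compact_imp_closed) auto
  moreover have "{0..<s} \<subseteq> {0..s} \<inter> \<delta> -` ?K"
  proof
    fix r assume "r \<in> {0..<s}"
    then show "r \<in> {0..s} \<inter> \<delta> -` ?K"
      using before[of r] chart_inv_chart[OF c(1), of "\<delta> r"] by (auto intro!: image_eqI[of _ _ "snd c (\<delta> r)"])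
  qed
  ultimately have "closure {0..<s} \<subseteq> {0..s} \<inter> \<delta> -` ?K" by (rule closure_minimal[rotated])
  moreover have "0 < s" using s start by (cases "s = 0") auto
  ultimately have sub: "{0..s} \<subseteq> \<delta> -` ?K" by simp
  have K: "y \<in> fst c \<and> snd c y \<in> cball u R" if "y \<in> ?K" for y
    using that c chart_inv_in[OF c(1)] chart_chart_inv[OF c(1)] by auto
  have "\<delta> s \<in> ?K" using subsetD[OF sub, of s] \<open>0 < s\<close> by simp
  then have "dist u (snd c (\<delta> s)) = R" using K[of "\<delta> s"] s by auto
  moreover have "\<And>r. r \<in> {0..s} \<Longrightarrow> \<delta> r \<in> fst c \<and> snd c (\<delta> r) \<in> cball u R" using sub K by blast
  ultimately show ?thesis using s by (intro that) auto
qed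

context
  fixes c u R m
  assumes c: "c \<in> A" "cball u R \<subseteq> snd c ` fst c"
    and m: "0 < m" "\<And>w y. w \<in> cball u R \<Longrightarrow> m * norm y \<le> local_rep A F c (w, y)"
begin

lemma length_ge_exit_start:
  assumes \<gamma>: "piecewise_smooth_curve A \<gamma>"
    and start: "\<gamma> 0 \<in> fst c" "snd c (\<gamma> 0) \<in> ball u R"
    and exit: "t \<in> {0..1}" "\<not> (\<gamma> t \<in> fst c \<and> snd c (\<gamma> t) \<in> ball u R)"
  shows "m * (R - dist u (snd c (\<gamma> 0))) \<le> finsler_length A F \<gamma>"
proof -
  obtain s where s: "s \<in> {0..1}" "dist u (snd c (\<gamma> s)) = R"
    "\<And>r. r \<in> {0..s} \<Longrightarrow> \<gamma> r \<in> fst c \<and> snd c (\<gamma> r) \<in> cball u R"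
    using chart_ball_exit[OF piecewise_smooth_curve_regular(1)[OF \<gamma>] c start exit] by blast
  have "m * norm (snd c (\<gamma> s) - snd c (\<gamma> 0)) \<le> finsler_length A F \<gamma>"
    by (rule length_ge_chart[OF \<gamma> _ _ _ c(1) s(3) m]) (use s(1) in auto)
  moreover have "m * (R - dist u (snd c (\<gamma> 0))) \<le> m * norm (snd c (\<gamma> s) - snd c (\<gamma> 0))"
    using s(2) m(1) dist_triangle[of u "snd c (\<gamma> s)" "snd c (\<gamma> 0)"]
    by (intro mult_left_mono) (simp_all add: dist_norm norm_minus_commute)
  ultimately show ?thesis by simp
qed

text \<open>The reversed path serves only as a continuous path, to locate the last entry into the
  ball. The length is still estimated along \<open>\<gamma>\<close> in its own direction, on
  [1 - s, 1].\<close>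

lemma length_ge_exit_end:
  assumes \<gamma>: "piecewise_smooth_curve A \<gamma>"
    and start: "\<gamma> 1 \<in> fst c" "snd c (\<gamma> 1) \<in> ball u R"
    and exit: "t \<in> {0..1}" "\<not> (\<gamma> t \<in> fst c \<and> snd c (\<gamma> t) \<in> ball u R)"
  shows "m * (R - dist u (snd c (\<gamma> 1))) \<le> finsler_length A F \<gamma>"
proof -
  let ?\<delta> = "\<lambda>t. \<gamma> (1 - t)"
  have "continuous_on {0..1} ?\<delta>"
    by (rule continuous_on_compose2[OF piecewise_smooth_curve_regular(1)[OF \<gamma>]])
      (auto intro: continuous_intros)
  then obtain s where s: "s \<in> {0..1}" "dist u (snd c (?\<delta> s)) = R"
    "\<And>r. r \<in> {0..s} \<Longrightarrow> ?\<delta> r \<in> fst c \<and> snd c (?\<delta> r) \<in> cball u R"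
    using chart_ball_exit[of ?\<delta> c u R "1 - t"] c start exit by auto
  have in_K: "\<gamma> r \<in> fst c \<and> snd c (\<gamma> r) \<in> cball u R" if "r \<in> {1 - s..1}" for r
    using s(3)[of "1 - r"] that by auto
  have "m * norm (snd c (\<gamma> 1) - snd c (\<gamma> (1 - s))) \<le> finsler_length A F \<gamma>"
    by (rule length_ge_chart[OF \<gamma> _ _ _ c(1) in_K m]) (use s(1) in auto)
  moreover have "m * (R - dist u (snd c (\<gamma> 1))) \<le> m * norm (snd c (\<gamma> 1) - snd c (\<gamma> (1 - s)))"
    using s(2) m(1) dist_triangle[of u "snd c (\<gamma> (1 - s))" "snd c (\<gamma> 1)"]
    by (intro mult_left_mono) (simp_all add: dist_norm)
  ultimately show ?thesis by simp
qed

lemma dist_ge_chart: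
  assumes p: "p \<in> fst c" "dist u (snd c p) \<le> R / 3" and q: "q \<in> fst c" "dist u (snd c q) \<le> R / 3"
    and R: "0 < R"
  shows "m * norm (snd c q - snd c p) \<le> d p q"
proof (rule dist_ge)
  fix \<gamma> assume \<gamma>: "piecewise_smooth_curve A \<gamma>" "\<gamma> 0 = p" "\<gamma> 1 = q"
  show "m * norm (snd c q - snd c p) \<le> finsler_length A F \<gamma>"
  proof (cases "\<forall>t\<in>{0..1}. \<gamma> t \<in> fst c \<and> snd c (\<gamma> t) \<in> ball u R")
    case True
    then have "\<gamma> r \<in> fst c \<and> snd c (\<gamma> r) \<in> cball u R" if "r \<in> {0..1}" for r
      using that less_imp_le by (metis mem_ball mem_cball)
    then have "m * norm (snd c (\<gamma> 1) - snd c (\<gamma> 0)) \<le> finsler_length A F \<gamma>"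
      by (intro length_ge_chart[where K = "cball u R", OF \<gamma>(1) _ _ _ c(1) _ m]) simp_all
    then show ?thesis using \<gamma> by simp
  next
    case False
    then obtain t where t: "t \<in> {0..1}" "\<not> (\<gamma> t \<in> fst c \<and> snd c (\<gamma> t) \<in> ball u R)" by blast
    \<comment> \<open>This is where R / 3 comes from: the left side is at most 2R/3 and the right
      side at least 2R/3. So a curve that leaves the ball is already long enough on its way
      out.\<close>
    have "norm (snd c q - snd c p) \<le> R - dist u (snd c p)"
      using p q dist_triangle[of "snd c q" "snd c p" u] by (simp add: dist_norm norm_minus_commute)
    then have "m * norm (snd c q - snd c p) \<le> m * (R - dist u (snd c p))" using m(1) by simp
    also have "\<dots> \<le> finsler_length A F \<gamma>"
      using length_ge_exit_start[OF \<gamma>(1) _ _ t] \<gamma> p R by simp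
    finally show ?thesis .
  qed
qed

lemma dist_ge_outside:
  assumes "p \<in> fst c" "snd c p = u" "0 < R" "\<not> (q \<in> fst c \<and> snd c q \<in> ball u R)"
  shows "m * R \<le> d p q" "m * R \<le> d q p"
proof -
  have "m * R \<le> finsler_length A F \<gamma>"
    if "piecewise_smooth_curve A \<gamma>" "\<gamma> 0 = p" "\<gamma> 1 = q" for \<gamma>
    using length_ge_exit_start[of \<gamma> 1] assms that by simp
  then show "m * R \<le> d p q" by (rule dist_ge)
  have "m * R \<le> finsler_length A F \<gamma>"
    if "piecewise_smooth_curve A \<gamma>" "\<gamma> 0 = q" "\<gamma> 1 = p" for \<gamma>
    using length_ge_exit_end[of \<gamma> 0] assms that by simp
  then show "m * R \<le> d q p" by (rule dist_ge)
qed

end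

text \<open>The threshold is m * R: a point outside the coordinate ball of radius R about x is at
  least that far from x in both directions.\<close>

lemma dist_small_imp_near:
  assumes "open V" "x \<in> V"
  shows "\<exists>e>0. \<forall>y. d x y < e \<or> d y x < e \<longrightarrow> y \<in> V"
proof -
  obtain c R m M where c: "c \<in> A" "x \<in> fst c" "0 < R" "cball (snd c x) R \<subseteq> snd c ` fst c"
    and V: "\<And>y. y \<in> fst c \<Longrightarrow> snd c y \<in> cball (snd c x) R \<Longrightarrow> y \<in> V"
    and m: "0 < m" "\<And>u y. u \<in> cball (snd c x) R \<Longrightarrow> m * norm y \<le> local_rep A F c (u, y)"
    by (rule chart_ball[OF assms]) blast
  have "y \<in> V" if "d x y < m * R \<or> d y x < m * R" for y
    using dist_ge_outside[OF c(1,4) m c(2) refl c(3), of y] V[of y] that by force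
  moreover have "0 < m * R" using m c by simp
  ultimately show ?thesis by blast
qed

text \<open>The symmetric coordinate norm mediates: the segment from q to p bounds
  \<open>d q p\<close> above by M times it, while \<open>d p q\<close> is at least m times it. This
  gives C = M / m.\<close>

lemma dist_locally_comparable:
  "\<exists>U C. open U \<and> x \<in> U \<and> 0 \<le> C \<and> (\<forall>p\<in>U. \<forall>q\<in>U. d q p \<le> C * d p q)"
proof -
  obtain c R m M where c: "c \<in> A" "x \<in> fst c" "0 < R" "cball (snd c x) R \<subseteq> snd c ` fst c"
    and mM: "0 < m" "0 < M"
    and m: "\<And>u y. u \<in> cball (snd c x) R \<Longrightarrow> m * norm y \<le> local_rep A F c (u, y)"
    and M: "\<And>u y. u \<in> cball (snd c x) R \<Longrightarrow> local_rep A F c (u, y) \<le> M * norm y"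
    by (rule chart_ball[of UNIV x]) auto
  let ?U = "fst c \<inter> snd c -` ball (snd c x) (R / 3)"
  have "d q p \<le> M / m * d p q" if pq: "p \<in> ?U" "q \<in> ?U" for p q
  proof -
    have "snd c p \<in> cball (snd c x) R" "snd c q \<in> cball (snd c x) R" using pq c(3) by auto
    then obtain \<gamma> where \<gamma>: "piecewise_smooth_curve A \<gamma>" "\<gamma> 0 = q" "\<gamma> 1 = p"
      "finsler_length A F \<gamma> \<le> M * norm (snd c p - snd c q)"
      using chart_segment[OF c(1) convex_cball c(4) _ _ M, of "snd c q" "snd c p"] pq c(1)
      by (auto simp: chart_inv_chart)
    have "d q p \<le> M * norm (snd c q - snd c p)"
      using dist_le_length[OF \<gamma>(1)] \<gamma> by (simp add: norm_minus_commute)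
    also have "\<dots> = M / m * (m * norm (snd c q - snd c p))" using mM by simp
    also have "\<dots> \<le> M / m * d p q"
      using mM dist_ge_chart[OF c(1,4) mM(1) m, of p q] pq c(3) by (intro mult_left_mono) auto
    finally show ?thesis .
  qed
  moreover have "open ?U" "x \<in> ?U" using c by (auto intro: open_chart_vimage)
  moreover have "0 \<le> M / m" using mM by simp
  ultimately show ?thesis by blast
qed

end


section \<open>Reversing a distance along a curve\<close>

text \<open>Bisection of [a, b]: increments of G are additive, so bounds on adjacent intervals
  combine, and continuity of G puts short pieces of the curve into one comparison
  neighbourhood.\<close>

lemma reversed_increment_bound:
  fixes D :: "'m::topological_space \<Rightarrow> 'm \<Rightarrow> real" and G :: "real \<Rightarrow> real"
  assumes ab: "a \<le> b"
    and triangle: "\<And>x y z. D x z \<le> D x y + D y z"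
    and near: "\<And>V x. open V \<Longrightarrow> x \<in> V \<Longrightarrow> \<exists>e>0. \<forall>y. D x y < e \<or> D y x < e \<longrightarrow> y \<in> V"
    and comparable: "\<And>x. \<exists>U C. open U \<and> x \<in> U \<and> 0 \<le> C \<and> (\<forall>p\<in>U. \<forall>q\<in>U. D q p \<le> C * D p q)"
    and G: "continuous_on {a..b} G" "\<And>s t. a \<le> s \<Longrightarrow> s \<le> t \<Longrightarrow> t \<le> b \<Longrightarrow> G s \<le> G t"
    and bound: "\<And>s t. a \<le> s \<Longrightarrow> s \<le> t \<Longrightarrow> t \<le> b \<Longrightarrow> D (\<gamma> s) (\<gamma> t) \<le> G t - G s"
  shows "\<exists>C\<ge>0. \<forall>s t. a \<le> s \<longrightarrow> s \<le> t \<longrightarrow> t \<le> b \<longrightarrow> D (\<gamma> t) (\<gamma> s) \<le> C * (G t - G s)"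
proof -
  \<comment> \<open>The local step of \<open>Bolzano\<close> ranges over all short intervals around
    a point, even those reaching outside [a, b]; hence s and t are also confined to [a, b].\<close>
  define P where "P u v \<longleftrightarrow> (\<exists>C\<ge>0. \<forall>s t. a \<le> s \<longrightarrow> u \<le> s \<longrightarrow> s \<le> t \<longrightarrow> t \<le> v \<longrightarrow> t \<le> b \<longrightarrow>
    D (\<gamma> t) (\<gamma> s) \<le> C * (G t - G s))" for u v
  have "P a b"
    using ab
  proof (induction rule: Bolzano)
    case (trans u v w)
    obtain C1 where C1: "C1 \<ge> 0" "\<And>s t. a \<le> s \<Longrightarrow> u \<le> s \<Longrightarrow> s \<le> t \<Longrightarrow> t \<le> v \<Longrightarrow> t \<le> b \<Longrightarrow>
        D (\<gamma> t) (\<gamma> s) \<le> C1 * (G t - G s)" using trans(1) unfolding P_def by blast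
    obtain C2 where C2: "C2 \<ge> 0" "\<And>s t. a \<le> s \<Longrightarrow> v \<le> s \<Longrightarrow> s \<le> t \<Longrightarrow> t \<le> w \<Longrightarrow> t \<le> b \<Longrightarrow>
        D (\<gamma> t) (\<gamma> s) \<le> C2 * (G t - G s)" using trans(2) unfolding P_def by blast
    \<comment> \<open>Increments of G are nonnegative, so both bounds survive passing to the larger
      constant.\<close>
    let ?C = "max C1 C2"
    have "D (\<gamma> t) (\<gamma> s) \<le> ?C * (G t - G s)"
      if st: "a \<le> s" "u \<le> s" "s \<le> t" "t \<le> w" "t \<le> b" for s t
    proof -
      have left: "D (\<gamma> y) (\<gamma> x) \<le> ?C * (G y - G x)" if "s \<le> x" "x \<le> y" "y \<le> t" "y \<le> v" for x y
        using C1(2)[of x y] G(2)[of x y] that st mult_right_mono[of C1 ?C "G y - G x"] by auto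
      have right: "D (\<gamma> y) (\<gamma> x) \<le> ?C * (G y - G x)" if "s \<le> x" "x \<le> y" "y \<le> t" "v \<le> x" for x y
        using C2(2)[of x y] G(2)[of x y] that st mult_right_mono[of C2 ?C "G y - G x"] by auto
      consider "t \<le> v" | "v \<le> s" | "s \<le> v" "v \<le> t" by linarith
      then show ?thesis
      proof cases
        case 3
        have "D (\<gamma> t) (\<gamma> s) \<le> D (\<gamma> t) (\<gamma> v) + D (\<gamma> v) (\<gamma> s)" by (rule triangle)
        also have "\<dots> \<le> ?C * (G t - G v) + ?C * (G v - G s)"
          using left[of s v] right[of v t] 3 by (intro add_mono) auto
        finally show ?thesis by (simp add: algebra_simps)
      qed (use left[of s t] right[of s t] st in auto)
    qed
    then show ?case unfolding P_def using C1(1) by (intro exI[of _ ?C]) auto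
  next
    case (local x)
    obtain U C where U: "open U" "\<gamma> x \<in> U" "0 \<le> C" "\<And>p q. p \<in> U \<Longrightarrow> q \<in> U \<Longrightarrow> D q p \<le> C * D p q"
      using comparable[of "\<gamma> x"] by blast
    obtain e where e: "e > 0" "\<And>y. D (\<gamma> x) y < e \<or> D y (\<gamma> x) < e \<Longrightarrow> y \<in> U"
      using near[OF U(1,2)] by blast
    obtain \<delta> where \<delta>: "\<delta> > 0" "\<And>t. t \<in> {a..b} \<Longrightarrow> \<bar>t - x\<bar> < \<delta> \<Longrightarrow> \<bar>G t - G x\<bar> < e"
      using G(1) local e(1) unfolding continuous_on_iff dist_real_def by (metis atLeastAtMost_iff)
    \<comment> \<open>\<open>bound\<close> controls the distance from \<open>\<gamma> x\<close> for
      t after x, but the distance to \<open>\<gamma> x\<close> for t before x. This is why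
      \<open>near\<close> accepts smallness in either direction.\<close>
    have in_U: "\<gamma> t \<in> U" if "a \<le> t" "t \<le> b" "\<bar>t - x\<bar> < \<delta>" for t
      using e(2)[of "\<gamma> t"] \<delta>(2)[of t] bound[of t x] bound[of x t] that local
      by (cases "t \<le> x") fastforce+
    have "P u v" if uv: "u \<le> x" "x \<le> v" "v - u < \<delta>" for u v
    proof -
      have "D (\<gamma> t) (\<gamma> s) \<le> C * (G t - G s)"
        if st: "a \<le> s" "u \<le> s" "s \<le> t" "t \<le> v" "t \<le> b" for s t
      proof -
        have "D (\<gamma> t) (\<gamma> s) \<le> C * D (\<gamma> s) (\<gamma> t)"
          using st uv by (intro U(4) in_U) auto
        also have "\<dots> \<le> C * (G t - G s)"
          using st U(3) by (intro mult_left_mono bound) auto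
        finally show ?thesis .
      qed
      then show ?thesis unfolding P_def using U(3) by blast
    qed
    then show ?case using \<delta>(1) by blast
  qed
  then show ?thesis unfolding P_def by auto
qed

text \<open>On a bounded interval constants are integrable, and for finite p the function is
  dominated through |x| <= 1 + |x|^p.\<close>

lemma Lp_on_Icc_integrable:
  assumes f: "f \<in> Lp_on p {a..b}" and p: "1 \<le> p"
  shows "integrable (lebesgue_on {a..b}) f"
proof -
  have meas: "f \<in> borel_measurable (lebesgue_on {a..b})" using f by (simp add: Lp_on_def)
  have const: "integrable (lebesgue_on {a..b}) (\<lambda>_. C)" for C :: real
    using integrable_const_ivl by blast
  show ?thesis
  proof (cases "p = \<infinity>")
    case True
    then obtain C where "AE s in lebesgue_on {a..b}. \<bar>f s\<bar> \<le> C" using f by (auto simp: Lp_on_def)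
    then show ?thesis
      by (intro Bochner_Integration.integrable_bound[OF const[of C] meas]) (auto elim: eventually_mono)
  next
    case False
    define q where "q = enn2real p"
    have "p = ennreal q" unfolding q_def using False by (simp add: less_top)
    then have q: "1 \<le> q" using p unfolding q_def by (metis ennreal_1 ennreal_le_iff2 enn2real_nonneg not_one_le_zero)
    have "integrable (lebesgue_on {a..b}) (\<lambda>s. 1 + \<bar>f s\<bar> powr q)"
      using f False const[of 1] by (auto simp: Lp_on_def q_def)
    moreover have "\<bar>x\<bar> \<le> 1 + \<bar>x\<bar> powr q" for x :: real
    proof (cases "\<bar>x\<bar> \<le> 1")
      case False
      then have "\<bar>x\<bar> powr 1 \<le> \<bar>x\<bar> powr q" using q by (intro powr_mono) auto
      then show ?thesis using False by simp
    qed (simp add: add_increasing2)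
    ultimately show ?thesis
      by (intro Bochner_Integration.integrable_bound[OF _ meas]) (auto simp: add_nonneg_nonneg)
  qed
qed

lemma Lp_on_scale:
  assumes "f \<in> Lp_on p I"
  shows "(\<lambda>s. C * f s) \<in> Lp_on p I"
proof -
  have "\<exists>K. AE s in lebesgue_on I. \<bar>C * f s\<bar> \<le> K" if "AE s in lebesgue_on I. \<bar>f s\<bar> \<le> K" for K
  proof
    show "AE s in lebesgue_on I. \<bar>C * f s\<bar> \<le> \<bar>C\<bar> * K"
      using that by eventually_elim (simp add: abs_mult mult_left_mono)
  qed
  then show ?thesis
    using assms by (auto simp: Lp_on_def abs_mult powr_mult)
qed

text \<open>Rewrites the integrals in \<open>FAC\<close> and \<open>BAC\<close> as increments of one
  primitive, which plays the role of G.\<close>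

lemma Lp_on_Icc_set_integral:
  assumes f: "f \<in> Lp_on p {a..b}" "1 \<le> p" and st: "a \<le> s" "s \<le> t" "t \<le> b"
  shows "(LINT r:{s..t}|lebesgue. f r) = integral {a..t} f - integral {a..s} f"
    and "f integrable_on {a..b}"
proof -
  have "set_integrable lebesgue {a..b} f"
    using Lp_on_Icc_integrable[OF f] by (simp add: set_integrable_def integrable_restrict_space)
  then have "set_integrable lebesgue {u..v} f" if "a \<le> u" "v \<le> b" for u v
    by (rule set_integrable_subset) (use that in auto)
  note eq = set_lebesgue_integral_eq_integral[OF this]
  show "f integrable_on {a..b}" by (rule eq) auto
  have "integral {a..s} f + integral {s..t} f = integral {a..t} f"
    using st by (intro Henstock_Kurzweil_Integration.integral_combine eq) auto
  then show "(LINT r:{s..t}|lebesgue. f r) = integral {a..t} f - integral {a..s} f"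
    using eq(2)[of s t] st by simp
qed

text \<open>The primitive of f is continuous, and monotone because f is nonnegative. The new
  integrand is a constant multiple of f, so the exponent p is preserved.\<close>

lemma reversed_Lp_bound:
  fixes D :: "'m::topological_space \<Rightarrow> 'm \<Rightarrow> real"
  assumes ab: "a \<le> b" and p: "1 \<le> p"
    and triangle: "\<And>x y z. D x z \<le> D x y + D y z"
    and near: "\<And>V x. open V \<Longrightarrow> x \<in> V \<Longrightarrow> \<exists>e>0. \<forall>y. D x y < e \<or> D y x < e \<longrightarrow> y \<in> V"
    and comparable: "\<And>x. \<exists>U C. open U \<and> x \<in> U \<and> 0 \<le> C \<and> (\<forall>p\<in>U. \<forall>q\<in>U. D q p \<le> C * D p q)"
    and f: "f \<in> Lp_on p {a..b}" "\<forall>s\<in>{a..b}. 0 \<le> f s"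
    and bound: "\<forall>t1\<in>{a..b}. \<forall>t2\<in>{a..b}. t1 \<le> t2 \<longrightarrow>
      D (\<gamma> t1) (\<gamma> t2) \<le> (LINT s:{t1..t2}|lebesgue. f s)"
  shows "\<exists>f\<in>Lp_on p {a..b}. (\<forall>s\<in>{a..b}. 0 \<le> f s) \<and>
    (\<forall>t1\<in>{a..b}. \<forall>t2\<in>{a..b}. t1 \<le> t2 \<longrightarrow>
      D (\<gamma> t2) (\<gamma> t1) \<le> (LINT s:{t1..t2}|lebesgue. f s))"
proof -
  let ?G = "\<lambda>t. integral {a..t} f"
  note LINT = Lp_on_Icc_set_integral(1)[OF f(1) p]
  have int: "f integrable_on {a..b}" using Lp_on_Icc_set_integral(2)[OF f(1) p, of a a] ab by simp
  have mono: "?G s \<le> ?G t" if st: "a \<le> s" "s \<le> t" "t \<le> b" for s t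
  proof -
    have "f integrable_on {a..s}" "f integrable_on {a..t}"
      using integrable_on_subinterval[OF int] st by auto
    then show ?thesis using st f(2) by (intro integral_subset_le) auto
  qed
  have "D (\<gamma> s) (\<gamma> t) \<le> ?G t - ?G s" if "a \<le> s" "s \<le> t" "t \<le> b" for s t
    using bound[rule_format, of s t] LINT[OF that] that by auto
  from reversed_increment_bound[OF ab triangle near comparable
      indefinite_integral_continuous_1[OF int] mono this]
  obtain C where C: "C \<ge> 0" "\<And>s t. a \<le> s \<Longrightarrow> s \<le> t \<Longrightarrow> t \<le> b \<Longrightarrow>
      D (\<gamma> t) (\<gamma> s) \<le> C * (?G t - ?G s)" by blast
  have rev: "D (\<gamma> t) (\<gamma> s) \<le> (LINT r:{s..t}|lebesgue. C * f r)"
    if "a \<le> s" "s \<le> t" "t \<le> b" for s t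
    using C(2)[OF that] LINT[OF that] by simp
  show ?thesis
  proof (intro bexI conjI ballI impI)
    show "(\<lambda>s. C * f s) \<in> Lp_on p {a..b}" by (rule Lp_on_scale[OF f(1)])
  qed (use C(1) f(2) rev in auto)
qed

theorem theorem3p6:
  fixes A :: "('m::{t2_space, second_countable_topology}, 'n::finite) chart set"
    and F :: "'m \<Rightarrow> (('m, 'n) chart \<Rightarrow> real ^ 'n) \<Rightarrow> real"
    and a b :: real and p :: ennreal
  assumes "finsler_manifold A F"
    and "a \<le> b"
    and "1 \<le> p"
  shows "FAC A F p {a..b} = BAC A F p {a..b} \<and> BAC A F p {a..b} = AC A F p {a..b}"
proof -
  interpret finsler A F by (unfold_locales) (rule assms(1))
  note local = dist_triangle_finsler dist_small_imp_near dist_locally_comparable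
  \<comment> \<open>A curve in \<open>BAC\<close> for d satisfies the \<open>FAC\<close> condition
    for the swapped distance, so the hypotheses on \<open>D\<close> are recorded for that one as
    well.\<close>
  have rev_triangle: "d z x \<le> d y x + d z y" for x y z
    using dist_triangle_finsler[of z x y] by simp
  have rev_near: "\<exists>e>0. \<forall>y. d y x < e \<or> d x y < e \<longrightarrow> y \<in> V" if "open V" "x \<in> V" for V x
    using dist_small_imp_near[OF that] by metis
  have rev_comparable: "\<exists>U C. open U \<and> x \<in> U \<and> 0 \<le> C \<and> (\<forall>p\<in>U. \<forall>q\<in>U. d p q \<le> C * d q p)" for x
    using dist_locally_comparable[of x] by metis
  have "FAC A F p {a..b} \<subseteq> BAC A F p {a..b}"
    unfolding FAC_def BAC_def using reversed_Lp_bound[of a b p d, OF assms(2,3) local] by blast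
  moreover have "BAC A F p {a..b} \<subseteq> FAC A F p {a..b}"
    unfolding FAC_def BAC_def
    using reversed_Lp_bound[of a b p "\<lambda>x y. d y x",
        OF assms(2,3) rev_triangle rev_near rev_comparable] by blast
  ultimately show ?thesis unfolding AC_def by blast
qed

end
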